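(* Let $A$ be an associative ring containing three pairwise orthogonal idempotents $e_1,e_2,e_3$ such that $Ae_iA=Ae_4A=A$ for $1\le i\le 3$, where $e_4=1-e_1-e_2-e_3$. Let $B$ be another associative ring such that $\operatorname{Ann}(\langle[B,B]\rangle)=(0)$. Then any isomorphism of Lie rings $\varphi:[A,A]\to[B,B]$ extends to a standard homomorphism; that is, there exists a standard additive mapping $\Phi:A\to B$ such that $\Phi(a)=\varphi(a)$ for all $a\in[A,A]$.
   Context: Rings are associative and not necessarily unital. $[R,R]$ is the additive subgroup of a ring $R$ generated by all commutators $[a,b]=ab-ba$, viewed as a Lie ring. $\langle[B,B]\rangle$ is the subring of $B$ generated by $[B,B]$. For a ring $C$, $\operatorname{Ann}(C)=\{c\in C\mid cC=Cc=(0)\}$. The ring $A$ is not assumed to contain $1$; $e_4$ lies in the unital hull $A+\mathbb{Z}\cdot1$ (which is $A$ itself if $A$ is unital). $AeA$ denotes the additive subgroup of $A$ generated by all $aeb$, $a,b\in A$ (for $e=e_4$: $ae_4b=ab-\sum_{i=1}^3ae_ib$). An additive mapping $\Phi:A\to B$ is called standard if there exist a ring homomorphism $\psi_1:A\to B$ and an anti-homomorphism $\psi_2:A\to B$ (additive, $\psi_2(ab)=\psi_2(b)\psi_2(a)$) such that (i) $\psi_1(A)\psi_2(A)=\psi_2(A)\psi_1(A)=(0)$ and (ii) $\Phi=\psi_1-\psi_2$. *)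

theory Defs
  imports Complex_Main "HOL-Computational_Algebra.Group_Closure"
begin

text \<open>
  Rings are types of class \<open>ring\<close>, hence associative and not necessarily unital.
\<close>

definition commutator :: "'a::ring \<Rightarrow> 'a \<Rightarrow> 'a"
  where "commutator a b = a * b - b * a"

definition derived_ring :: "'a::ring set"
  where "derived_ring = group_closure {commutator a b | a b. True}"

definition is_subring :: "'a::ring set \<Rightarrow> bool"
  where "is_subring S \<longleftrightarrow>
    0 \<in> S \<and> (\<forall>x\<in>S. \<forall>y\<in>S. x - y \<in> S) \<and> (\<forall>x\<in>S. \<forall>y\<in>S. x * y \<in> S)"

definition generated_subring :: "'a::ring set \<Rightarrow> 'a set"
  where "generated_subring X = is_subring hull X"

definition annihilator :: "'a::ring set \<Rightarrow> 'a set"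
  where "annihilator C = {c \<in> C. \<forall>x\<in>C. c * x = 0 \<and> x * c = 0}"

definition two_sided_product :: "'a::ring \<Rightarrow> 'a set"
  where "two_sided_product e = group_closure {a * e * b | a b. True}"

text \<open>
  The additive group \<open>A (1 - s) A\<close>, where \<open>1 - s\<close> lies in the unital hull of \<open>A\<close>:
  there \<open>a (1 - s) b = a b - a s b\<close>, which is again an element of \<open>A\<close>.
\<close>

definition two_sided_product_compl :: "'a::ring \<Rightarrow> 'a set"
  where "two_sided_product_compl s = group_closure {a * b - a * s * b | a b. True}"

lemma two_sided_product_compl_unital:
  "two_sided_product_compl s = two_sided_product (1 - s)" for s :: "'a::ring_1"
  by (simp add: two_sided_product_compl_def two_sided_product_def algebra_simps)

text \<open>
  \<open>\<phi>\<close> is a total function, but only its values on the Lie ring \<open>L\<close> are constrained.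
\<close>

definition lie_ring_iso_on :: "'a::ring set \<Rightarrow> 'b::ring set \<Rightarrow> ('a \<Rightarrow> 'b) \<Rightarrow> bool"
  where "lie_ring_iso_on L M \<phi> \<longleftrightarrow>
    bij_betw \<phi> L M \<and>
    (\<forall>x\<in>L. \<forall>y\<in>L. \<phi> (x + y) = \<phi> x + \<phi> y) \<and>
    (\<forall>x\<in>L. \<forall>y\<in>L. \<phi> (commutator x y) = commutator (\<phi> x) (\<phi> y))"

definition ring_homomorphism :: "('a::ring \<Rightarrow> 'b::ring) \<Rightarrow> bool"
  where "ring_homomorphism \<psi> \<longleftrightarrow> additive \<psi> \<and> (\<forall>a b. \<psi> (a * b) = \<psi> a * \<psi> b)"

definition ring_antihomomorphism :: "('a::ring \<Rightarrow> 'b::ring) \<Rightarrow> bool"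
  where "ring_antihomomorphism \<psi> \<longleftrightarrow> additive \<psi> \<and> (\<forall>a b. \<psi> (a * b) = \<psi> b * \<psi> a)"

definition standard_map :: "('a::ring \<Rightarrow> 'b::ring) \<Rightarrow> bool"
  where "standard_map \<Phi> \<longleftrightarrow> additive \<Phi> \<and>
    (\<exists>\<psi>1 \<psi>2. ring_homomorphism \<psi>1 \<and> ring_antihomomorphism \<psi>2 \<and>
      (\<forall>a b. \<psi>1 a * \<psi>2 b = 0 \<and> \<psi>2 a * \<psi>1 b = 0) \<and>
      (\<forall>a. \<Phi> a = \<psi>1 a - \<psi>2 a))"

end

theory Submission
  imports Defs
begin

text \<open>
  Write \<open>A\<^sub>i\<^sub>j\<close> for \<open>e\<^sub>i A e\<^sub>j\<close>, \<open>L = [A, A]\<close>, \<open>M = [B, B]\<close>, \<open>M\<^sub>i\<^sub>j = \<phi> A\<^sub>i\<^sub>j\<close> for \<open>i \<noteq> j\<close>,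
  and \<open>R\<close> for the subring generated by \<open>M\<close>. Fullness of the idempotents says that
  \<open>A\<^sub>i\<^sub>j A\<^sub>j\<^sub>k\<close> spans \<open>A\<^sub>i\<^sub>k\<close>; hence \<open>L\<close> is spanned by the off-diagonal blocks together with
  the commutators \<open>[A\<^sub>i\<^sub>j, A\<^sub>j\<^sub>i]\<close>, and \<open>R\<close> is generated by the \<open>M\<^sub>i\<^sub>j\<close>.

  If \<open>\<phi> = \<psi>\<^sub>1 - \<psi>\<^sub>2\<close> with \<open>\<psi>\<^sub>1\<close> a homomorphism and \<open>\<psi>\<^sub>2\<close> an orthogonal anti-homomorphism, then
  \<open>M\<^sub>i\<^sub>j M\<^sub>k\<^sub>l = 0\<close> whenever \<open>j \<noteq> k\<close> and \<open>i \<noteq> l\<close>. The heart of the proof is to establish these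
  relations directly (\<open>phi_mult_eq_0\<close>). The essential case is that of four distinct indices, which
  implies the others. Let \<open>P = X Y\<close> with \<open>X \<in> M\<^sub>i\<^sub>j\<close>, \<open>Y \<in> M\<^sub>k\<^sub>l\<close>. Since \<open>M = [B, B]\<close>, the map
  \<open>ad P\<close> sends \<open>M\<close> to itself and so pulls back along \<open>\<phi>\<close> to a derivation \<open>D\<close> of \<open>L\<close>. For the
  block grading with respect to \<open>{i, k}\<close> and \<open>{j, l}\<close> it should have degree two, hence vanish
  outside the blocks from \<open>{j, l}\<close> to \<open>{i, k}\<close>; but \<open>B\<close> carries no grading, and this vanishing
  has to be extracted from explicit commutation relations and from elements \<open>e\<^sub>p - t\<close> of \<open>L\<close> that act
  on most blocks as \<open>e\<^sub>p\<close> does (\<open>ad_pullback_mult_row\<close>, \<open>ad_pullback_mult_column\<close>). These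
  arguments compare weights that differ by one, so no assumption on the characteristic enters.
  A derivation of \<open>L\<close> with that vanishing is zero (\<open>derivation_eq_0\<close>). Therefore \<open>P\<close> is central
  in \<open>R\<close>. Centrality of all these products already gives \<open>M\<^sub>i\<^sub>j M\<^sub>i\<^sub>l = M\<^sub>i\<^sub>l M\<^sub>k\<^sub>l = M\<^sub>i\<^sub>j M\<^sub>i\<^sub>j = 0\<close>,
  and then \<open>P\<close> annihilates \<open>M\<^sub>i\<^sub>j\<close>, hence the Lie ideal generated by it, hence \<open>R\<close>; so
  \<open>P = 0\<close> because \<open>R\<close> has zero annihilator.

  Now let \<open>i, j, k\<close> be distinct. The products \<open>M\<^sub>i\<^sub>j M\<^sub>j\<^sub>k\<close> generate a subring \<open>R\<^sub>1\<close>, the products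
  \<open>M\<^sub>j\<^sub>k M\<^sub>i\<^sub>j\<close> a subring \<open>R\<^sub>2\<close>. The vanishing products give \<open>R\<^sub>1 R\<^sub>2 = R\<^sub>2 R\<^sub>1 = 0\<close>, and
  \<open>\<phi> (x y) = \<phi> x \<phi> y - \<phi> y \<phi> x\<close> shows that \<open>M\<^sub>i\<^sub>k \<subseteq> R\<^sub>1 + R\<^sub>2\<close>. An element of both
  subrings annihilates \<open>R\<close>, so the sum is direct, and \<open>\<phi>\<close> splits off the diagonal as
  \<open>\<phi>\<^sub>1 - \<phi>\<^sub>2\<close> with \<open>\<phi>\<^sub>1 x \<phi>\<^sub>1 y = \<phi>\<^sub>1 (x y)\<close> and \<open>\<phi>\<^sub>2 y \<phi>\<^sub>2 x = \<phi>\<^sub>2 (x y)\<close> as far as this makes sense.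
  Such partial homomorphisms extend to all of \<open>A\<close>: an element of a diagonal block is sent to the
  element that multiplies the off-diagonal images as it should, which is unique by faithfulness
  (locale \<open>block_extension\<close>). The difference of the two extensions is the standard map.
\<close>

section \<open>Commutators, generated subrings and four indices\<close>

lemma derived_ring_diff: "x \<in> derived_ring \<Longrightarrow> y \<in> derived_ring \<Longrightarrow> x - y \<in> derived_ring"
  unfolding derived_ring_def by (rule group_closure.diff)

lemma derived_ring_zero [simp]: "0 \<in> derived_ring"
  unfolding derived_ring_def by simp

lemma derived_ring_uminus [simp]: "- x \<in> derived_ring \<longleftrightarrow> x \<in> derived_ring"
  unfolding derived_ring_def by simp

lemma derived_ring_add: "x \<in> derived_ring \<Longrightarrow> y \<in> derived_ring \<Longrightarrow> x + y \<in> derived_ring"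
  unfolding derived_ring_def by (rule group_closure_add)

lemma commutator_in_derived_ring [simp]: "commutator x y \<in> derived_ring"
  unfolding derived_ring_def by (rule group_closure.base) blast

lemma commutator_diff_left: "commutator (x - y) z = commutator x z - commutator y z"
  by (simp add: commutator_def algebra_simps)

lemma commutator_diff_right: "commutator z (x - y) = commutator z x - commutator z y"
  by (simp add: commutator_def algebra_simps)

lemma commutator_zero [simp]: "commutator 0 x = 0" "commutator x 0 = 0"
  by (simp_all add: commutator_def)

lemma commutator_leibniz:
  "commutator p (commutator x y) = commutator (commutator p x) y + commutator x (commutator p y)"
  by (simp add: commutator_def algebra_simps)

lemma is_subring_generated_subring: "is_subring (generated_subring X)"
  unfolding generated_subring_def by (rule hull_in) (auto simp: is_subring_def)

lemma generated_subring_inc: "x \<in> X \<Longrightarrow> x \<in> generated_subring X"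
  unfolding generated_subring_def by (rule hull_inc)

lemma generated_subring_subset: "X \<subseteq> S \<Longrightarrow> is_subring S \<Longrightarrow> generated_subring X \<subseteq> S"
  unfolding generated_subring_def by (rule hull_minimal)

lemma generated_subring_mult_eq_0:
  fixes X Y :: "'b::ring set"
  assumes "\<And>x y. x \<in> X \<Longrightarrow> y \<in> Y \<Longrightarrow> x * y = 0"
    and "a \<in> generated_subring X" "b \<in> generated_subring Y"
  shows "a * b = 0"
proof -
  have "is_subring {y. x * y = 0}" for x :: 'b
    by (auto simp: is_subring_def right_diff_distrib simp flip: mult.assoc)
  then have "x * b = 0" if "x \<in> X" for x
    using generated_subring_subset [of Y "{y. x * y = 0}"] assms that by blast
  moreover have "is_subring {x. x * b = 0}"
    by (auto simp: is_subring_def left_diff_distrib mult.assoc)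
  ultimately show ?thesis
    using generated_subring_subset [of X "{x. x * b = 0}"] assms by blast
qed

lemma subring_zero: "is_subring S \<Longrightarrow> 0 \<in> S"
  and subring_diff: "is_subring S \<Longrightarrow> x \<in> S \<Longrightarrow> y \<in> S \<Longrightarrow> x - y \<in> S"
  and subring_mult: "is_subring S \<Longrightarrow> x \<in> S \<Longrightarrow> y \<in> S \<Longrightarrow> x * y \<in> S"
  by (simp_all add: is_subring_def)

text \<open>
  Indices of the Peirce decomposition. There are exactly four: three suffice to form
  \<open>A\<^sub>i\<^sub>j A\<^sub>j\<^sub>k\<close>, and the fourth provides room for an index avoiding three given ones.
\<close>

datatype idx = I1 | I2 | I3 | I4

lemma UNIV_idx: "UNIV = {I1, I2, I3, I4}"
  using idx.exhaust by auto

instance idx :: finite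
  by standard (simp add: UNIV_idx)

lemma sum_idx: "(\<Sum>i\<in>UNIV. f i) = f I1 + f I2 + f I3 + f I4"
  by (simp add: UNIV_idx add.assoc)

lemma ex_idx_avoiding:
  obtains t :: idx where "t \<noteq> a" "t \<noteq> b" "t \<noteq> c"
proof -
  have "card {a, b, c} < card (UNIV :: idx set)"
    by (simp add: UNIV_idx card_insert_if)
  then have "{a, b, c} \<noteq> UNIV"
    by (metis less_irrefl)
  then show thesis
    using that by blast
qed

lemma idx_cases_distinct:
  fixes i j k l p :: idx
  assumes "distinct [i, j, k, l]"
  obtains "p = i" | "p = j" | "p = k" | "p = l"
proof -
  have "card {i, j, k, l} = card (UNIV :: idx set)"
    using assms by (simp add: UNIV_idx)
  then have "{i, j, k, l} = UNIV"
    by (simp add: card_subset_eq)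
  then show thesis
    using that by blast
qed

section \<open>Peirce decompositions with four indices\<close>

text \<open>
  The idempotents are represented by the operators \<open>a \<mapsto> e\<^sub>i a\<close> and \<open>a \<mapsto> a e\<^sub>i\<close>, because
  \<open>e\<^sub>4\<close> need not lie in the ring. All that remains of the special role of \<open>e\<^sub>4\<close> is that, of any
  two indices, only one is sure to belong to an idempotent of the ring.
\<close>

locale peirce_frame =
  fixes lm rm :: "idx \<Rightarrow> 'a::ring \<Rightarrow> 'a"
  assumes lm_diff: "lm i (a - b) = lm i a - lm i b"
    and rm_diff: "rm i (a - b) = rm i a - rm i b"
    and lm_mult: "lm i (a * b) = lm i a * b"
    and rm_mult: "rm i (a * b) = a * rm i b"
    and rm_mult_lm: "rm i a * b = a * lm i b"
    and lm_lm: "lm i (lm j a) = (if i = j then lm i a else 0)"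
    and rm_rm: "rm i (rm j a) = (if i = j then rm i a else 0)"
    and lm_rm: "lm i (rm j a) = rm j (lm i a)"
    and sum_lm: "(\<Sum>i\<in>UNIV. lm i a) = a"
    and sum_rm: "(\<Sum>i\<in>UNIV. rm i a) = a"
    and full: "a \<in> group_closure {x * lm i y | x y. True}"
    and unital: "i \<noteq> j \<Longrightarrow> (\<exists>e. \<forall>a. lm i a = e * a \<and> rm i a = a * e) \<or> (\<exists>e. \<forall>a. lm j a = e * a \<and> rm j a = a * e)"
begin

definition block :: "idx \<Rightarrow> idx \<Rightarrow> 'a set"
  where "block i j = {a. lm i a = a \<and> rm j a = a}"

definition component :: "idx \<Rightarrow> idx \<Rightarrow> 'a \<Rightarrow> 'a"
  where "component i j a = lm i (rm j a)"

definition has_unit :: "idx \<Rightarrow> bool"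
  where "has_unit i \<longleftrightarrow> (\<exists>e. \<forall>a. lm i a = e * a \<and> rm i a = a * e)"

lemma lm_zero [simp]: "lm i 0 = 0" and rm_zero [simp]: "rm i 0 = 0"
  using lm_diff [of i 0 0] rm_diff [of i 0 0] by simp_all

lemma lm_uminus: "lm i (- a) = - lm i a" and rm_uminus: "rm i (- a) = - rm i a"
  using lm_diff [of i 0 a] rm_diff [of i 0 a] by simp_all

lemma lm_add: "lm i (a + b) = lm i a + lm i b" and rm_add: "rm i (a + b) = rm i a + rm i b"
  using lm_diff [of i a "- b"] rm_diff [of i a "- b"] by (simp_all add: lm_uminus rm_uminus)

lemma component_zero [simp]: "component i j 0 = 0"
  by (simp add: component_def)

lemma component_diff: "component i j (a - b) = component i j a - component i j b"
  by (simp add: component_def lm_diff rm_diff)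

lemma component_add: "component i j (a + b) = component i j a + component i j b"
  by (simp add: component_def lm_add rm_add)

lemma component_uminus: "component i j (- a) = - component i j a"
  by (simp add: component_def lm_uminus rm_uminus)

lemma component_in_block [simp]: "component i j a \<in> block i j"
  by (simp add: component_def block_def lm_lm rm_rm lm_rm)

lemma component_block:
  assumes "x \<in> block r s"
  shows "component i j x = (if i = r \<and> j = s then x else 0)"
proof -
  have "lm i x = (if i = r then x else 0)" for i
    using assms lm_lm [of i r x] by (auto simp: block_def)
  moreover have "rm j x = (if j = s then x else 0)" for j
    using assms rm_rm [of j s x] by (auto simp: block_def)
  ultimately show ?thesis
    by (simp add: component_def)
qed

lemma block_zero [simp]: "0 \<in> block i j"
  by (simp add: block_def)

lemma block_diff: "x \<in> block i j \<Longrightarrow> y \<in> block i j \<Longrightarrow> x - y \<in> block i j"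
  by (simp add: block_def lm_diff rm_diff)

lemma block_add: "x \<in> block i j \<Longrightarrow> y \<in> block i j \<Longrightarrow> x + y \<in> block i j"
  by (simp add: block_def lm_add rm_add)

lemma block_uminus: "x \<in> block i j \<Longrightarrow> - x \<in> block i j"
  by (simp add: block_def lm_uminus rm_uminus)

lemma block_mult: "x \<in> block i j \<Longrightarrow> y \<in> block k l \<Longrightarrow> x * y \<in> block i l"
  by (simp add: block_def lm_mult rm_mult)

lemma block_mult_eq_0:
  assumes "x \<in> block i j" "y \<in> block k l" "j \<noteq> k"
  shows "x * y = 0"
proof -
  have "x * y = rm j x * lm k y"
    using assms by (simp add: block_def)
  also have "\<dots> = x * lm j (lm k y)"
    by (simp add: rm_mult_lm)
  finally show ?thesis
    using assms by (simp add: lm_lm)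
qed

lemma component_mult_left:
  assumes "x \<in> block r s"
  shows "component p q (x * a) = (if p = r then x * component s q a else 0)"
proof -
  have "component p q (x * a) = lm p (lm r x) * rm q a" "x * component s q a = rm s x * rm q a"
    using assms unfolding component_def rm_mult_lm [symmetric]
    by (simp_all add: block_def lm_mult rm_mult)
  then show ?thesis
    using assms by (simp add: lm_lm block_def)
qed

lemma component_mult_right:
  assumes "x \<in> block r s"
  shows "component p q (a * x) = (if q = s then component p r a * x else 0)"
proof -
  have "component p q (a * x) = lm p a * rm q (rm s x)" "component p r a * x = lm p a * lm r x"
    using assms by (simp_all add: component_def block_def lm_mult rm_mult rm_mult_lm lm_rm)
  then show ?thesis
    using assms by (simp add: rm_rm block_def)
qed

lemma sum_component: "(\<Sum>p\<in>UNIV. \<Sum>q\<in>UNIV. component p q a) = a"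
proof -
  have "(\<Sum>q\<in>UNIV. component p q a) = lm p a" for p
    unfolding component_def using sum_rm [of "lm p a"] by (simp add: lm_rm)
  then show ?thesis
    by (simp add: sum_lm)
qed

lemma eq_0_if_components_eq_0: "(\<And>p q. component p q a = 0) \<Longrightarrow> a = 0"
  using sum_component [of a] by simp

lemma eq_component_if_others_0:
  assumes "\<And>p q. (p, q) \<noteq> (r, s) \<Longrightarrow> component p q a = 0"
  shows "a = component r s a"
proof -
  have "component p q (a - component r s a) = 0" for p q
    using assms [of p q] by (auto simp: component_diff component_block [OF component_in_block])
  then show ?thesis
    using eq_0_if_components_eq_0 [of "a - component r s a"] by simp
qed

text \<open>
  Fullness of \<open>e\<^sub>j\<close> in the form in which it is used throughout: a property of \<open>e\<^sub>i A e\<^sub>k\<close>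
  that is compatible with differences need only be checked on products passing through \<open>j\<close>.
\<close>

lemma block_induct [consumes 1, case_names zero diff mult]:
  assumes u: "u \<in> block i k"
    and zero: "Q 0"
    and diff: "\<And>a b. a \<in> block i k \<Longrightarrow> b \<in> block i k \<Longrightarrow> Q a \<Longrightarrow> Q b \<Longrightarrow> Q (a - b)"
    and mult: "\<And>x y. x \<in> block i j \<Longrightarrow> y \<in> block j k \<Longrightarrow> Q (x * y)"
  shows "Q u"
proof -
  have "Q (component i k v)" if "v \<in> group_closure {x * lm j y | x y. True}" for v
    using that
  proof induction
    case (base s)
    then consider "s = 0" | x y where "s = x * lm j y"
      by auto
    then show ?case
    proof cases
      case 1
      then show ?thesis by (simp add: zero)
    next
      case (2 x y)
      have "rm j (lm i x) * lm j (rm k y) = lm i x * lm j (rm k y)"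
        by (simp add: rm_mult_lm lm_lm)
      also have "\<dots> = component i k s"
        unfolding 2 component_def lm_mult rm_mult lm_rm ..
      finally have "component i k s = rm j (lm i x) * lm j (rm k y)" ..
      moreover have "rm j (lm i x) \<in> block i j" "lm j (rm k y) \<in> block j k"
        by (simp_all add: block_def lm_lm rm_rm lm_rm)
      ultimately show ?thesis
        by (simp add: mult)
    qed
  next
    case (diff s t)
    then show ?case
      by (simp add: component_diff assms(3))
  qed
  then have "Q (component i k u)"
    using full by blast
  then show ?thesis
    using u by (simp add: component_block)
qed

lemma has_unit_or: "i \<noteq> j \<Longrightarrow> has_unit i \<or> has_unit j"
  using unital [of i j] by (simp add: has_unit_def)

lemma block_in_derived_ring:
  assumes "i \<noteq> j" "u \<in> block i j"
  shows "u \<in> derived_ring"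
proof -
  obtain k where k: "k \<noteq> i" "k \<noteq> j" "k \<noteq> j"
    by (rule ex_idx_avoiding [of i j j])
  show ?thesis
    using \<open>u \<in> block i j\<close>
  proof (induction rule: block_induct [where j = k])
    case (mult x y)
    then have "x * y = commutator x y"
      using assms block_mult_eq_0 [of y k j x i k] by (simp add: commutator_def)
    then show ?case
      by simp
  qed (simp_all add: derived_ring_diff)
qed

lemma commutator_blocks_chain:
  assumes "x \<in> block i j" "y \<in> block j k" "i \<noteq> k"
  shows "commutator x y = x * y"
  using assms block_mult_eq_0 [of y j k x i j] by (simp add: commutator_def)

lemma commutator_blocks_eq_0:
  assumes "x \<in> block i j" "y \<in> block k l" "j \<noteq> k" "i \<noteq> l"
  shows "commutator x y = 0"
  using assms block_mult_eq_0 [of y k l x i j] block_mult_eq_0 [of x i j y k l]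
  by (simp add: commutator_def)

text \<open>
  An element acting as \<open>e\<^sub>i\<close> is determined only up to the annihilator of the ring; its
  component in the block \<open>(i, i)\<close> acts in the same way.
\<close>

lemma has_unitE:
  assumes "has_unit i"
  obtains e where "e \<in> block i i" "\<And>a. lm i a = e * a" "\<And>a. rm i a = a * e"
proof -
  obtain e' where e': "\<And>a. lm i a = e' * a" "\<And>a. rm i a = a * e'"
    using assms(1) unfolding has_unit_def by blast
  define e where "e = component i i e'"
  have "lm i a = e * a" "rm i a = a * e" for a
  proof -
    have "e * a = lm i (lm i (lm i a))"
      unfolding e_def component_def lm_mult [symmetric] rm_mult_lm by (simp add: e'(1) lm_mult mult.assoc)
    moreover have "a * e = rm i (rm i (rm i a))"
      unfolding e_def component_def lm_rm rm_mult [symmetric] rm_mult_lm [symmetric] by (simp add: e'(2) rm_mult mult.assoc)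
    ultimately show "lm i a = e * a" "rm i a = a * e"
      by (simp_all add: lm_lm rm_rm)
  qed
  then show thesis
    using that [of e] by (simp add: e_def)
qed

text \<open>
  The idempotent \<open>e\<^sub>i\<close> is usually not a sum of commutators, but writing it as a sum of
  products \<open>x y\<close> through \<open>k\<close> and subtracting the products \<open>y x\<close> gives an element
  \<open>h = e\<^sub>i - t\<close> of \<open>[A, A]\<close>. On the blocks that avoid \<open>k\<close> it has the same adjoint action as
  \<open>e\<^sub>i\<close>. These elements take the role of the grading operators.
\<close>

lemma commutator_lm_rm:
  assumes "has_unit i" "k \<noteq> i"
  obtains h t where "h \<in> derived_ring" "t \<in> block k k"
    "\<And>a. commutator h a = lm i a - rm i a - (t * a - a * t)"
proof -
  obtain e where e: "e \<in> block i i" "\<And>a. lm i a = e * a" "\<And>a. rm i a = a * e"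
    by (rule has_unitE [OF assms(1)]) (rule that)
  from e(1) have "\<exists>t\<in>block k k. e - t \<in> derived_ring"
  proof (induction rule: block_induct [where j = k])
    case (diff a b)
    then obtain s t where "s \<in> block k k" "t \<in> block k k" "a - s \<in> derived_ring" "b - t \<in> derived_ring"
      by blast
    then have "s - t \<in> block k k" "(a - b) - (s - t) \<in> derived_ring"
      using derived_ring_diff [of "a - s" "b - t"] by (simp_all add: block_diff algebra_simps)
    then show ?case
      by blast
  next
    case (mult x y)
    then have "y * x \<in> block k k" "x * y - y * x \<in> derived_ring"
      using block_mult commutator_in_derived_ring [of x y] by (auto simp: commutator_def)
    then show ?case
      by blast
  qed (auto intro: bexI [of _ 0])
  then obtain t where "t \<in> block k k" "e - t \<in> derived_ring"
    by blast
  then show thesis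
    by (intro that [of "e - t" t]) (simp_all add: commutator_def e algebra_simps)
qed

text \<open>
  Diagonal commutators reduce to off-diagonal ones through
  \<open>[x y, b] = [x, y b] + [y, b x]\<close>, so \<open>[A, A]\<close> is spanned by the off-diagonal blocks and the
  commutators of opposite ones.
\<close>

lemma derived_ring_induct [consumes 1, case_names diff off_diagonal commutator]:
  assumes l: "l \<in> derived_ring"
    and diff: "\<And>x y. x \<in> derived_ring \<Longrightarrow> y \<in> derived_ring \<Longrightarrow> Q x \<Longrightarrow> Q y \<Longrightarrow> Q (x - y)"
    and off: "\<And>i j x. i \<noteq> j \<Longrightarrow> x \<in> block i j \<Longrightarrow> Q x"
    and comm: "\<And>i j x y. i \<noteq> j \<Longrightarrow> x \<in> block i j \<Longrightarrow> y \<in> block j i \<Longrightarrow> Q (commutator x y)"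
  shows "Q l"
proof -
  have zero: "Q 0"
    using off [of I1 I2 0] by simp
  have uminus: "Q (- x)" if "x \<in> derived_ring" "Q x" for x
    using diff [of 0 x] zero that by simp
  have add: "Q (x + y)" if "x \<in> derived_ring" "y \<in> derived_ring" "Q x" "Q y" for x y
    using diff [of x "- y"] uminus [of y] that by simp
  have diag: "Q (commutator a b)" if "a \<in> block i i" "b \<in> block i i" for i a b
  proof -
    obtain k where k: "k \<noteq> i" "k \<noteq> i" "k \<noteq> i"
      by (rule ex_idx_avoiding [of i i i])
    show ?thesis
      using \<open>a \<in> block i i\<close>
    proof (induction rule: block_induct [where j = k])
      case (diff x y)
      then show ?case
        by (simp add: commutator_diff_left assms(2))
    next
      case (mult x y)
      have "commutator (x * y) b = commutator x (y * b) + commutator y (b * x)"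
        by (simp add: commutator_def algebra_simps)
      moreover have "y * b \<in> block k i" "b * x \<in> block i k"
        using mult that block_mult by blast+
      ultimately show ?case
        using mult k comm [of i k x "y * b"] comm [of k i y "b * x"] by (simp add: add)
    qed (simp add: zero)
  qed
  have blocks: "Q (commutator a b)" if "a \<in> block p q" "b \<in> block r s" for p q r s a b
  proof (cases "q = r")
    case True
    show ?thesis
    proof (cases "p = s")
      case True
      then show ?thesis
        using \<open>q = r\<close> that diag comm by (cases "p = q") auto
    next
      case False
      then show ?thesis
        using commutator_blocks_chain [of a p q b s] off [of p s "a * b"] block_mult \<open>q = r\<close> that
        by auto
    qed
  next
    case False
    show ?thesis
    proof (cases "p = s")
      case True
      have "commutator a b = - (b * a)"
        using False that block_mult_eq_0 by (auto simp: commutator_def)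
      moreover have "b * a \<in> block r q"
        using that block_mult by blast
      ultimately show ?thesis
        using off [of r q "- (b * a)"] False by (simp add: block_uminus)
    next
      case False
      then show ?thesis
        using commutator_blocks_eq_0 [of a p q b r s] \<open>q \<noteq> r\<close> that zero by simp
    qed
  qed
  have sum: "Q (\<Sum>p\<in>UNIV. g p) \<and> (\<Sum>p\<in>UNIV. g p) \<in> derived_ring"
    if "\<And>p. Q (g p) \<and> g p \<in> derived_ring" for g :: "idx \<Rightarrow> 'a"
    unfolding sum_idx using that by (simp add: add derived_ring_add)
  have expand: "commutator a b = (\<Sum>p\<in>UNIV. \<Sum>q\<in>UNIV. commutator (component p q a) b)"
    "commutator b a = (\<Sum>p\<in>UNIV. \<Sum>q\<in>UNIV. commutator b (component p q a))" for a b
    by (simp_all add: commutator_def sum_subtractf sum_component flip: sum_distrib_left sum_distrib_right)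
  have "Q (commutator a b) \<and> commutator a b \<in> derived_ring" if "b \<in> block r s" for a b r s
    unfolding expand(1) [of a b]
    by (rule sum, rule sum) (simp add: blocks [OF component_in_block that])
  then have all: "Q (commutator a b) \<and> commutator a b \<in> derived_ring" for a b
    unfolding expand(2) [of a b]
    by (intro sum) (use component_in_block in blast)
  from l have "l \<in> group_closure {commutator a b | a b. True}"
    by (simp add: derived_ring_def)
  then have "Q l \<and> l \<in> derived_ring"
  proof induction
    case (base s)
    then show ?case
      using zero all by auto
  next
    case (diff s t)
    then show ?case
      by (simp add: assms(2) derived_ring_diff)
  qed
  then show ?thesis ..
qed

text \<open>
  Fullness moves an annihilation relation from one block to the next:
  \<open>A\<^sub>b\<^sub>d\<close> is spanned by \<open>A\<^sub>b\<^sub>c A\<^sub>c\<^sub>d\<close>.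
\<close>

lemma right_cancel_extend:
  assumes "v \<in> block a b" "\<And>z. z \<in> block b c \<Longrightarrow> v * z = 0" "z \<in> block b d"
  shows "v * z = 0"
  using assms(3)
proof (induction rule: block_induct [where j = c])
  case (mult x y)
  then show ?case
    using assms(2) [of x] by (simp flip: mult.assoc)
qed (simp_all add: right_diff_distrib)

lemma left_cancel_extend:
  assumes "v \<in> block a b" "\<And>z. z \<in> block c a \<Longrightarrow> z * v = 0" "z \<in> block d a"
  shows "z * v = 0"
  using assms(3)
proof (induction rule: block_induct [where j = c])
  case (mult x y)
  then show ?case
    using assms(2) [of y] by (simp add: mult.assoc)
qed (simp_all add: left_diff_distrib)

lemma right_cancel:
  assumes "has_unit b" "v \<in> block a b" "\<And>z. z \<in> block b c \<Longrightarrow> v * z = 0"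
  shows "v = 0"
proof -
  obtain e where e: "e \<in> block b b" "\<And>x. lm b x = e * x" "\<And>x. rm b x = x * e"
    by (rule has_unitE [OF assms(1)]) (rule that)
  have "v = v * e"
    using e(3) [of v] assms(2) by (simp add: block_def)
  then show ?thesis
    using right_cancel_extend [OF assms(2,3) e(1)] by simp
qed

lemma left_cancel:
  assumes "has_unit a" "v \<in> block a b" "\<And>z. z \<in> block c a \<Longrightarrow> z * v = 0"
  shows "v = 0"
proof -
  obtain e where e: "e \<in> block a a" "\<And>x. lm a x = e * x" "\<And>x. rm a x = x * e"
    by (rule has_unitE [OF assms(1)]) (rule that)
  have "v = e * v"
    using e(2) [of v] assms(2) by (simp add: block_def)
  then show ?thesis
    using left_cancel_extend [OF assms(2,3) e(1)] by simp
qed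

text \<open>
  One-sided annihilators may be nonzero at the index without a unit. Two-sided
  annihilation of an off-diagonal element is enough, since one of its two indices has a unit.
\<close>

lemma two_sided_cancel:
  assumes "a \<noteq> b" "v \<in> block a b"
    and "\<And>z. z \<in> block b c \<Longrightarrow> v * z = 0" "\<And>z. z \<in> block d a \<Longrightarrow> z * v = 0"
  shows "v = 0"
  using has_unit_or [OF assms(1)] left_cancel [OF _ assms(2,4)] right_cancel [OF _ assms(2,3)]
  by blast

lemma component_lm: "component p q (lm i a) = (if p = i then component p q a else 0)"
  by (simp add: component_def lm_lm flip: lm_rm)

lemma component_rm: "component p q (rm i a) = (if q = i then component p q a else 0)"
  by (simp add: component_def rm_rm)

lemma component_weight:
  assumes "t \<in> block k k"
  shows "component p q (lm i a - rm i a - (t * a - a * t)) =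
    (if p = i then component p q a else 0) - (if q = i then component p q a else 0)
     - ((if p = k then t * component k q a else 0) - (if q = k then component p k a * t else 0))"
  by (simp add: component_diff component_lm component_rm component_mult_left [OF assms] component_mult_right [OF assms])

lemma weight_block:
  assumes "t \<in> block k k" "x \<in> block p q" "p \<noteq> k" "q \<noteq> k"
  shows "lm i x - rm i x - (t * x - x * t) = (if p = i then x else 0) - (if q = i then x else 0)"
proof -
  have "t * x = 0" "x * t = 0"
    using assms block_mult_eq_0 by auto
  moreover have "lm i x = (if p = i then x else 0)"
    using assms(2) lm_lm [of i p x] by (auto simp: block_def)
  moreover have "rm i x = (if q = i then x else 0)"
    using assms(2) rm_rm [of i q x] by (auto simp: block_def)
  ultimately show ?thesis
    by simp
qed

end

section \<open>Derivations of the derived Lie ring\<close>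

definition lie_derivation :: "('a::ring \<Rightarrow> 'a) \<Rightarrow> bool"
  where "lie_derivation D \<longleftrightarrow>
    (\<forall>x\<in>derived_ring. \<forall>y\<in>derived_ring. D (x - y) = D x - D y) \<and>
    (\<forall>x\<in>derived_ring. \<forall>y\<in>derived_ring. D (commutator x y) = commutator (D x) y + commutator x (D y))"

lemma lie_derivation_diff:
  "lie_derivation D \<Longrightarrow> x \<in> derived_ring \<Longrightarrow> y \<in> derived_ring \<Longrightarrow> D (x - y) = D x - D y"
  by (simp add: lie_derivation_def)

lemma lie_derivation_commutator:
  "lie_derivation D \<Longrightarrow> x \<in> derived_ring \<Longrightarrow> y \<in> derived_ring \<Longrightarrow>
    D (commutator x y) = commutator (D x) y + commutator x (D y)"
  by (simp add: lie_derivation_def)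

lemma lie_derivation_zero: "lie_derivation D \<Longrightarrow> D 0 = 0"
  using lie_derivation_diff [of D 0 0] by simp

context peirce_frame
begin

text \<open>
  An element of \<open>A\<^sub>a\<^sub>c\<close> is a sum of commutators \<open>[x, y]\<close> with \<open>x \<in> A\<^sub>a\<^sub>b\<close>. If \<open>D x = 0\<close>, then
  \<open>D [x, y] = [x, D y]\<close> can only have components in row \<open>a\<close> or column \<open>b\<close>. Using this for several
  \<open>b\<close> confines \<open>D\<close> to few blocks without any grading on \<open>D\<close>.
\<close>

lemma component_derivation_left:
  assumes D: "lie_derivation D" and "distinct [a, b, c]"
    and "\<And>x. x \<in> block a b \<Longrightarrow> D x = 0" and "u \<in> block a c" "p \<noteq> a" "q \<noteq> b"
  shows "component p q (D u) = 0"
  using \<open>u \<in> block a c\<close>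
proof (induction rule: block_induct [where j = b])
  case zero
  then show ?case
    by (simp add: lie_derivation_zero [OF D])
next
  case (diff x y)
  then show ?case
    using assms(2) block_in_derived_ring [of a c] by (simp add: lie_derivation_diff [OF D] component_diff)
next
  case (mult x y)
  have "D (x * y) = D (commutator x y)"
    using commutator_blocks_chain [OF mult] assms(2) by simp
  also have "\<dots> = commutator (D x) y + commutator x (D y)"
    using assms(2) mult block_in_derived_ring by (intro lie_derivation_commutator [OF D]) auto
  finally have "D (x * y) = commutator x (D y)"
    using assms(3) mult by simp
  then show ?case
    using assms mult(1)
    by (simp add: commutator_def component_diff component_mult_left component_mult_right)
qed

lemma component_derivation_right:
  assumes D: "lie_derivation D" and "distinct [a, b, c]"
    and "\<And>x. x \<in> block b c \<Longrightarrow> D x = 0" and "u \<in> block a c" "p \<noteq> b" "q \<noteq> c"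
  shows "component p q (D u) = 0"
  using \<open>u \<in> block a c\<close>
proof (induction rule: block_induct [where j = b])
  case zero
  then show ?case
    by (simp add: lie_derivation_zero [OF D])
next
  case (diff x y)
  then show ?case
    using assms(2) block_in_derived_ring [of a c] by (simp add: lie_derivation_diff [OF D] component_diff)
next
  case (mult x y)
  have "D (x * y) = D (commutator x y)"
    using commutator_blocks_chain [OF mult] assms(2) by simp
  also have "\<dots> = commutator (D x) y + commutator x (D y)"
    using assms(2) mult block_in_derived_ring by (intro lie_derivation_commutator [OF D]) auto
  finally have "D (x * y) = commutator (D x) y"
    using assms(3) mult by simp
  then show ?case
    using assms mult(2)
    by (simp add: commutator_def component_diff component_mult_left component_mult_right)
qed

text \<open>
  By the previous two lemmas, \<open>D u\<close> for \<open>u \<in> A\<^sub>j\<^sub>i\<close> has components only in the blocks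
  \<open>(j, i)\<close> and \<open>(k, l)\<close>: degrees zero and two. The second is excluded by applying \<open>D\<close> to
  \<open>[A\<^sub>j\<^sub>i, A\<^sub>l\<^sub>k] = 0\<close>. This step uses the commutator itself and not its class modulo the
  centre; modulo the centre, \<open>sl\<^sub>4\<close> in characteristic two has such a derivation. The component
  in \<open>(j, i)\<close> is excluded by double commutators of \<open>u\<close> that land in blocks where \<open>D\<close> vanishes.
\<close>

lemma derivation_block_eq_0:
  assumes D: "lie_derivation D" and dist: "distinct [i, j, k, l]"
    and kill: "\<And>a b u. a \<noteq> b \<Longrightarrow> \<not> (a \<in> {j, l} \<and> b \<in> {i, k}) \<Longrightarrow> u \<in> block a b \<Longrightarrow> D u = 0"
    and u: "u \<in> block j i"
  shows "D u = 0"
proof -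
  have support: "component p q (D w) = 0"
    if "w \<in> block b a" "b \<in> {j, l}" "a \<in> {i, k}" "b' \<in> {j, l}" "a' \<in> {i, k}" "b \<noteq> b'" "a \<noteq> a'"
      "(p, q) \<noteq> (b, a)" "(p, q) \<noteq> (a', b')" for w a b a' b' p q
  proof -
    have "distinct [b, b', a]" "distinct [b, a', a]"
      using that dist by auto
    moreover have "D x = 0" if "x \<in> block b b'" for x
      by (rule kill [OF _ _ that]) (use dist \<open>b' \<in> {j, l}\<close> \<open>b \<noteq> b'\<close> in auto)
    moreover have "D x = 0" if "x \<in> block a' a" for x
      by (rule kill [OF _ _ that]) (use dist \<open>a' \<in> {i, k}\<close> \<open>a \<noteq> a'\<close> in auto)
    ultimately show ?thesis
      using component_derivation_left [OF D _ _ \<open>w \<in> block b a\<close>, of b' p q]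
        component_derivation_right [OF D _ _ \<open>w \<in> block b a\<close>, of a' p q] that by fastforce
  qed
  have in_L: "w \<in> derived_ring" if "w \<in> block a b" "a \<noteq> b" for w a b
    using block_in_derived_ring that by blast
  \<comment> \<open>Degree two: the diagonal components of \<open>D [u, v] = 0\<close>.\<close>
  have kl: "component k l (D u) = 0"
  proof (rule two_sided_cancel)
    show "component k l (D u) \<in> block k l" "k \<noteq> l"
      using dist by simp_all
  next
    fix v assume v: "v \<in> block l k"
    have "commutator u v = 0"
      using commutator_blocks_eq_0 [OF u v] dist by simp
    then have "commutator (D u) v + commutator u (D v) = 0"
      using lie_derivation_commutator [OF D in_L [OF u] in_L [OF v]] lie_derivation_zero [OF D] dist by auto
    then have *: "component p q (D u * v - v * D u + (u * D v - D v * u)) = 0" for p q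
      by (simp add: commutator_def)
    show "component k l (D u) * v = 0" "v * component k l (D u) = 0"
      using *[of k k] *[of l l] dist
      by (auto simp: component_add component_diff component_mult_left [OF u] component_mult_left [OF v]
          component_mult_right [OF u] component_mult_right [OF v])
  qed
  define d where "d = component j i (D u)"
  have d: "d \<in> block j i"
    by (simp add: d_def)
  have Du: "D u = d"
    unfolding d_def
  proof (rule eq_component_if_others_0)
    show "component p q (D u) = 0" if "(p, q) \<noteq> (j, i)" for p q
      using support [OF u, of l k p q] kl dist that by (cases "(p, q) = (k, l)") auto
  qed
  have bracket: "commutator (D u) z = D (commutator u z)" if "z \<in> block i j" for z
  proof -
    have "D z = 0"
      by (rule kill [OF _ _ that]) (use dist in auto)
    then show ?thesis
      using lie_derivation_commutator [OF D in_L [OF u] in_L [OF that]] dist by simp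
  qed
  \<comment> \<open>\<open>[[u, z], v] = u z v\<close> lies in a block killed by \<open>D\<close>, as do \<open>z\<close> and \<open>v\<close>.\<close>
  have right0: "d * (z * v) = 0" if z: "z \<in> block i j" and v: "v \<in> block j l" for z v
  proof -
    have expand: "commutator (commutator w z) v = w * (z * v)" if "w \<in> block j i" for w
      using block_mult_eq_0 [OF that v] block_mult_eq_0 [OF v that] block_mult_eq_0 [OF v z] dist
      by (auto simp: commutator_def left_diff_distrib right_diff_distrib mult.assoc)
         (auto simp flip: mult.assoc)
    have "D v = 0"
      by (rule kill [OF _ _ v]) (use dist in auto)
    have "d * (z * v) = commutator (D (commutator u z)) v"
      using expand [OF d] bracket [OF z] by (simp add: Du)
    also have "\<dots> = D (commutator (commutator u z) v)"
      using lie_derivation_commutator [OF D _ in_L [OF v], of "commutator u z"] \<open>D v = 0\<close> dist by auto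
    also have "\<dots> = D (u * (z * v))"
      by (simp add: expand [OF u])
    also have "\<dots> = 0"
      using block_mult [OF u block_mult [OF z v]] dist by (intro kill [of j l]) auto
    finally show ?thesis .
  qed
  have left0: "(v * z) * d = 0" if z: "z \<in> block i j" and v: "v \<in> block k i" for z v
  proof -
    have expand: "commutator v (commutator w z) = - ((v * z) * w)" if "w \<in> block j i" for w
      using block_mult_eq_0 [OF v that] block_mult_eq_0 [OF that v] block_mult_eq_0 [OF z v] dist
      by (auto simp: commutator_def left_diff_distrib right_diff_distrib mult.assoc)
         (auto simp flip: mult.assoc)
    have "D v = 0"
      by (rule kill [OF _ _ v]) (use dist in auto)
    have "- ((v * z) * d) = commutator v (D (commutator u z))"
      using expand [OF d] bracket [OF z] by (simp add: Du)
    also have "\<dots> = D (commutator v (commutator u z))"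
      using lie_derivation_commutator [OF D in_L [OF v], of "commutator u z"] \<open>D v = 0\<close> dist by auto
    also have "\<dots> = D (- ((v * z) * u))"
      by (simp add: expand [OF u])
    also have "\<dots> = 0"
      using block_uminus [OF block_mult [OF block_mult [OF v z] u]] dist by (intro kill [of k i]) auto
    finally show ?thesis
      by simp
  qed
  have "d = 0"
  proof (rule two_sided_cancel [OF _ d])
    show "d * x = 0" if "x \<in> block i l" for x
      using that
    proof (induction rule: block_induct [where j = j])
      case (mult x y)
      then show ?case using right0 by simp
    qed (simp_all add: right_diff_distrib)
    show "x * d = 0" if "x \<in> block k j" for x
      using that
    proof (induction rule: block_induct [where j = i])
      case (mult x y)
      then show ?case using left0 by simp
    qed (simp_all add: left_diff_distrib)
  qed (use dist in auto)
  then show ?thesis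
    by (simp add: Du)
qed

lemma derivation_eq_0:
  assumes D: "lie_derivation D" and dist: "distinct [i, j, k, l]"
    and kill: "\<And>a b u. a \<noteq> b \<Longrightarrow> \<not> (a \<in> {j, l} \<and> b \<in> {i, k}) \<Longrightarrow> u \<in> block a b \<Longrightarrow> D u = 0"
    and u: "u \<in> derived_ring"
  shows "D u = 0"
proof -
  have off: "D x = 0" if "a \<noteq> b" "x \<in> block a b" for a b x
  proof (cases "a \<in> {j, l} \<and> b \<in> {i, k}")
    case True
    have "D x = 0" if "x \<in> block j i"
      using D dist kill that by (rule derivation_block_eq_0)
    moreover have "D x = 0" if "x \<in> block j k"
      by (rule derivation_block_eq_0 [OF D _ _ that, of i l]) (use dist kill in auto)
    moreover have "D x = 0" if "x \<in> block l i"
      by (rule derivation_block_eq_0 [OF D _ _ that, of k j]) (use dist kill in auto)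
    moreover have "D x = 0" if "x \<in> block l k"
      by (rule derivation_block_eq_0 [OF D _ _ that, of i j]) (use dist kill in auto)
    ultimately show ?thesis
      using True \<open>x \<in> block a b\<close> by auto
  next
    case False
    then show ?thesis
      using kill that by blast
  qed
  from u show ?thesis
  proof (induction rule: derived_ring_induct)
    case (diff x y)
    then show ?case
      by (simp add: lie_derivation_diff [OF D])
  next
    case (off_diagonal i j x)
    then show ?case
      by (rule off)
  next
    case (commutator i j x y)
    then show ?case
      using lie_derivation_commutator [OF D, of x y] block_in_derived_ring [of i j x]
        block_in_derived_ring [of j i y] off [of i j x] off [of j i y] by simp
  qed
qed

text \<open>
  The blocks from \<open>{i, k}\<close> to \<open>{j, l}\<close> are the positive part of a grading whose degree zero
  part contains \<open>u\<close>. If \<open>D\<close> kills the positive part, it kills \<open>[z, u]\<close> and \<open>z\<close>, and the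
  Leibniz rule leaves \<open>[z, D u] = 0\<close>.
\<close>

lemma positive_derivation_block_commutes:
  assumes D: "lie_derivation D" and dist: "distinct [i, j, k, l]"
    and kill: "\<And>a b u. a \<in> {i, k} \<Longrightarrow> b \<in> {j, l} \<Longrightarrow> u \<in> block a b \<Longrightarrow> D u = 0"
    and u: "u \<in> block i k \<or> u \<in> block j l" and z: "a \<in> {i, k}" "b \<in> {j, l}" "z \<in> block a b"
  shows "commutator z (D u) = 0"
proof -
  have "D (commutator z u) = 0"
    using u
  proof
    assume u: "u \<in> block i k"
    have "commutator z u = - (u * z)"
      using block_mult_eq_0 [OF z(3) u] z dist by (auto simp: commutator_def)
    then show ?thesis
      using block_mult_eq_0 [OF u z(3)] block_uminus [OF block_mult [OF u z(3)]] kill [of i b] z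
        lie_derivation_zero [OF D] by (cases "a = k") auto
  next
    assume u: "u \<in> block j l"
    have "commutator z u = z * u"
      using block_mult_eq_0 [OF u z(3)] z dist by (auto simp: commutator_def)
    then show ?thesis
      using block_mult_eq_0 [OF z(3) u] block_mult [OF z(3) u] kill [of a l] z
        lie_derivation_zero [OF D] by (cases "b = j") auto
  qed
  moreover have "z \<in> derived_ring"
    using z dist block_in_derived_ring [of a b z] by auto
  moreover have "u \<in> derived_ring"
    using u dist block_in_derived_ring by auto
  ultimately show ?thesis
    using lie_derivation_commutator [OF D, of z u] kill [OF z] by simp
qed

text \<open>
  A Lie ideal that contains one off-diagonal block contains all of them, since bracketing with
  other blocks changes either index.
\<close>

lemma off_diagonal_in_lie_ideal:
  assumes "i0 \<noteq> j0" and gen: "\<And>x. x \<in> block i0 j0 \<Longrightarrow> Q x"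
    and diff: "\<And>x y. x \<in> derived_ring \<Longrightarrow> y \<in> derived_ring \<Longrightarrow> Q x \<Longrightarrow> Q y \<Longrightarrow> Q (x - y)"
    and ideal: "\<And>x y. x \<in> derived_ring \<Longrightarrow> y \<in> derived_ring \<Longrightarrow> Q x \<Longrightarrow> Q (commutator x y)"
    and "i \<noteq> j" "x \<in> block i j"
  shows "Q x"
proof -
  define inside where "inside a b \<longleftrightarrow> (\<forall>x\<in>block a b. Q x)" for a b
  have zero: "Q 0"
    using gen [of 0] by simp
  have uminus: "Q (- x)" if "x \<in> derived_ring" "Q x" for x
    using diff [of 0 x] zero that by simp
  have row: "inside a c" if "inside a b" "distinct [a, b, c]" for a b c
    unfolding inside_def
  proof
    fix w assume "w \<in> block a c"
    then show "Q w"
    proof (induction rule: block_induct [where j = b])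
      case (diff x y)
      then show ?case
        using assms(3) [of x y] block_in_derived_ring [of a c] that by simp
    next
      case (mult x y)
      then show ?case
        using ideal [of x y] block_in_derived_ring [of a b x] block_in_derived_ring [of b c y]
          commutator_blocks_chain [OF mult] that by (auto simp: inside_def)
    qed (rule zero)
  qed
  have col: "inside c b" if "inside a b" "distinct [a, b, c]" for a b c
    unfolding inside_def
  proof
    fix w assume "w \<in> block c b"
    then show "Q w"
    proof (induction rule: block_induct [where j = a])
      case (diff x y)
      then show ?case
        using assms(3) [of x y] block_in_derived_ring [of c b] that by auto
    next
      case (mult x y)
      have "x * y = - commutator y x"
        using commutator_blocks_chain [OF mult] that by (auto simp: commutator_def)
      then show ?case
        using ideal [of y x] uminus [of "commutator y x"] mult
          block_in_derived_ring [of c a x] block_in_derived_ring [of a b y] that by (auto simp: inside_def)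
    qed (rule zero)
  qed
  have f1: "inside i0 b" if "b \<noteq> i0" for b
    using row [of i0 j0 b] that assms(1,2) by (cases "b = j0") (auto simp: inside_def)
  have f2: "inside a b" if "a \<noteq> b" "b \<noteq> i0" for a b
    using col [OF f1 [of b], of a] f1 [of b] that by (cases "a = i0") auto
  have f3: "inside a i0" if "a \<noteq> i0" for a
  proof -
    obtain c where "c \<noteq> a" "c \<noteq> i0" "c \<noteq> i0"
      by (rule ex_idx_avoiding)
    then show ?thesis
      using row [OF f2 [of a c], of i0] that by auto
  qed
  show ?thesis
    using f2 [of i j] f3 [of i] assms(5,6) by (cases "j = i0") (auto simp: inside_def)
qed

end

section \<open>The Lie isomorphism and the associative ring generated by its image\<close>

locale lie_iso = peirce_frame lm rm
  for lm rm :: "idx \<Rightarrow> 'a::ring \<Rightarrow> 'a" +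
  fixes \<phi> :: "'a \<Rightarrow> 'b::ring"
  assumes iso: "lie_ring_iso_on (derived_ring :: 'a set) (derived_ring :: 'b set) \<phi>"
    and ann: "annihilator (generated_subring (derived_ring :: 'b set)) = {0}"
begin

abbreviation subring_B :: "'b set"
  where "subring_B \<equiv> generated_subring derived_ring"

lemma phi_add: "u \<in> derived_ring \<Longrightarrow> v \<in> derived_ring \<Longrightarrow> \<phi> (u + v) = \<phi> u + \<phi> v"
  using iso by (simp add: lie_ring_iso_on_def)

lemma phi_commutator:
  "u \<in> derived_ring \<Longrightarrow> v \<in> derived_ring \<Longrightarrow> \<phi> (commutator u v) = commutator (\<phi> u) (\<phi> v)"
  using iso by (simp add: lie_ring_iso_on_def)

lemma phi_zero [simp]: "\<phi> 0 = 0"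
  using phi_add [of 0 0] by simp

lemma phi_uminus: "u \<in> derived_ring \<Longrightarrow> \<phi> (- u) = - \<phi> u"
  using phi_add [of u "- u"] by (simp add: eq_neg_iff_add_eq_0 add.commute)

lemma phi_diff: "u \<in> derived_ring \<Longrightarrow> v \<in> derived_ring \<Longrightarrow> \<phi> (u - v) = \<phi> u - \<phi> v"
  using phi_add [of u "- v"] by (simp add: phi_uminus)

lemma phi_bij: "bij_betw \<phi> derived_ring derived_ring"
  using iso by (simp add: lie_ring_iso_on_def)

lemma phi_in: "u \<in> derived_ring \<Longrightarrow> \<phi> u \<in> derived_ring"
  using phi_bij by (auto simp: bij_betw_def)

lemma phi_eq_iff: "u \<in> derived_ring \<Longrightarrow> v \<in> derived_ring \<Longrightarrow> \<phi> u = \<phi> v \<longleftrightarrow> u = v"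
  using phi_bij by (auto simp: bij_betw_def inj_on_def)

lemma is_subring_B: "is_subring subring_B"
  by (rule is_subring_generated_subring)

lemma derived_in_subring_B: "b \<in> derived_ring \<Longrightarrow> b \<in> subring_B"
  by (rule generated_subring_inc)

lemma phi_in_subring_B: "u \<in> derived_ring \<Longrightarrow> \<phi> u \<in> subring_B"
  by (simp add: derived_in_subring_B phi_in)

lemma subring_B_mult: "x \<in> subring_B \<Longrightarrow> y \<in> subring_B \<Longrightarrow> x * y \<in> subring_B"
  using is_subring_B by (simp add: is_subring_def)

text \<open>
  The associative ring generated by \<open>[B, B]\<close> is already generated by the images of the
  off-diagonal blocks, since the remaining part of \<open>[A, A]\<close> consists of commutators of them.
\<close>

lemma phi_image_induct [consumes 1, case_names zero diff off_diagonal mult]: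
  assumes "r \<in> subring_B"
    and zero: "Q 0"
    and diff: "\<And>x y. Q x \<Longrightarrow> Q y \<Longrightarrow> Q (x - y)"
    and off: "\<And>i j u. i \<noteq> j \<Longrightarrow> u \<in> block i j \<Longrightarrow> Q (\<phi> u)"
    and mult: "\<And>x y. Q x \<Longrightarrow> Q y \<Longrightarrow> Q (x * y)"
  shows "Q r"
proof -
  have "Q (\<phi> l)" if "l \<in> derived_ring" for l
    using that
  proof (induction rule: derived_ring_induct)
    case (diff x y)
    then show ?case
      by (simp add: phi_diff assms(3))
  next
    case (off_diagonal i j x)
    then show ?case
      by (rule off)
  next
    case (commutator i j x y)
    then have "\<phi> (commutator x y) = commutator (\<phi> x) (\<phi> y)"
      using phi_commutator [of x y] block_in_derived_ring [of i j x] block_in_derived_ring [of j i y] by simp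
    then have "\<phi> (commutator x y) = \<phi> x * \<phi> y - \<phi> y * \<phi> x"
      by (simp add: commutator_def [of "\<phi> x"])
    then show ?case
      using commutator off [of i j x] off [of j i y] by (simp add: mult diff)
  qed
  then have "Q b" if "b \<in> derived_ring" for b
  proof -
    have "b \<in> \<phi> ` derived_ring"
      using that phi_bij by (simp add: bij_betw_def)
    then show ?thesis
      using \<open>\<And>l. l \<in> derived_ring \<Longrightarrow> Q (\<phi> l)\<close> by auto
  qed
  then show ?thesis
    by (rule hull_induct [OF assms(1) [unfolded generated_subring_def]])
       (auto simp: is_subring_def zero diff mult)
qed

lemma subring_B_eq_0:
  assumes c: "c \<in> subring_B"
    and 0: "\<And>i j u. i \<noteq> j \<Longrightarrow> u \<in> block i j \<Longrightarrow> c * \<phi> u = 0 \<and> \<phi> u * c = 0"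
  shows "c = 0"
proof -
  have "c * r = 0 \<and> r * c = 0" if "r \<in> subring_B" for r
    using that
  proof (induction rule: phi_image_induct)
    case (mult x y)
    then have "(c * x) * y = 0" "x * (y * c) = 0"
      by simp_all
    then show ?case
      by (simp add: mult.assoc)
  qed (auto simp: 0 left_diff_distrib right_diff_distrib)
  then have "c \<in> annihilator subring_B"
    using c by (simp add: annihilator_def)
  then show ?thesis
    using ann by simp
qed

section \<open>Products of off-diagonal images that vanish\<close>

text \<open>
  \<open>ad p\<close> maps \<open>[B, B]\<close> into itself for every \<open>p \<in> B\<close>, also for associative products
  \<open>p\<close> of commutators, and so transports to a derivation of \<open>[A, A]\<close>. For this, the image of
  \<open>\<phi>\<close> has to be a Lie ideal of \<open>B\<close>: the isomorphism of \<open>sl\<^sub>4\<close> with the Lie subring \<open>so\<^sub>6\<close> of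
  the complex matrices of size six is not standard.
\<close>

definition ad_pullback :: "'b \<Rightarrow> 'a \<Rightarrow> 'a"
  where "ad_pullback p u = inv_into derived_ring \<phi> (commutator p (\<phi> u))"

lemma ad_pullback_in: "ad_pullback p u \<in> derived_ring"
  and phi_ad_pullback: "\<phi> (ad_pullback p u) = commutator p (\<phi> u)"
proof -
  have "commutator p (\<phi> u) \<in> \<phi> ` derived_ring"
    using phi_bij by (simp add: bij_betw_def)
  then show "ad_pullback p u \<in> derived_ring" "\<phi> (ad_pullback p u) = commutator p (\<phi> u)"
    by (simp_all add: ad_pullback_def inv_into_into f_inv_into_f)
qed

lemma lie_derivation_ad_pullback: "lie_derivation (ad_pullback p)"
  unfolding lie_derivation_def
proof (intro conjI ballI)
  fix x y :: 'a
  assume L: "x \<in> derived_ring" "y \<in> derived_ring"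
  have "\<phi> (ad_pullback p (x - y)) = \<phi> (ad_pullback p x - ad_pullback p y)"
    using L by (simp add: phi_ad_pullback phi_diff ad_pullback_in commutator_diff_right)
  then show "ad_pullback p (x - y) = ad_pullback p x - ad_pullback p y"
    by (simp add: phi_eq_iff ad_pullback_in derived_ring_diff)
  have "\<phi> (ad_pullback p (commutator x y)) =
    \<phi> (commutator (ad_pullback p x) y + commutator x (ad_pullback p y))"
    using L by (simp add: phi_ad_pullback phi_add phi_commutator ad_pullback_in commutator_leibniz [of p "\<phi> x" "\<phi> y"])
  then show "ad_pullback p (commutator x y) =
    commutator (ad_pullback p x) y + commutator x (ad_pullback p y)"
    by (simp add: phi_eq_iff ad_pullback_in derived_ring_add)
qed

lemma phi_ad_pullback_mult:
  assumes "x \<in> derived_ring" "y \<in> derived_ring" "u \<in> derived_ring"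
  shows "\<phi> (ad_pullback (\<phi> x * \<phi> y) u) = \<phi> x * \<phi> (commutator y u) + \<phi> (commutator x u) * \<phi> y"
  using assms by (simp add: phi_ad_pullback phi_commutator) (simp add: commutator_def algebra_simps)

lemma ad_pullback_mult_eq_0:
  assumes "x \<in> derived_ring" "y \<in> derived_ring" "u \<in> derived_ring" "commutator x u = 0" "commutator y u = 0"
  shows "ad_pullback (\<phi> x * \<phi> y) u = 0"
proof -
  have "\<phi> (ad_pullback (\<phi> x * \<phi> y) u) = \<phi> 0"
    using assms by (simp add: phi_ad_pullback_mult)
  then show ?thesis
    by (simp only: phi_eq_iff ad_pullback_in derived_ring_zero)
qed

text \<open>
  An element \<open>v\<close> with \<open>\<phi> v = \<phi> x \<phi> y\<close> is an eigenvector of \<open>ad h\<close> when \<open>x\<close> and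
  \<open>y\<close> are, and the weights add up. This is how weights in the ungraded ring \<open>B\<close> are read
  off in \<open>A\<close>.
\<close>

lemma commutator_eq_if_phi_mult:
  assumes "h \<in> derived_ring" "x \<in> derived_ring" "y \<in> derived_ring" "v \<in> derived_ring" "z \<in> derived_ring"
    and "\<phi> v = \<phi> x * \<phi> y"
    and "\<phi> (commutator h x) * \<phi> y + \<phi> x * \<phi> (commutator h y) = \<phi> z"
  shows "commutator h v = z"
proof -
  have "\<phi> (commutator h v) = commutator (\<phi> h) (\<phi> x * \<phi> y)"
    using assms by (simp add: phi_commutator)
  also have "\<dots> = commutator (\<phi> h) (\<phi> x) * \<phi> y + \<phi> x * commutator (\<phi> h) (\<phi> y)"
    by (simp add: commutator_def algebra_simps)
  also have "\<dots> = \<phi> z"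
    using assms by (simp add: phi_commutator)
  finally have "\<phi> (commutator h v) = \<phi> z" .
  then show ?thesis
    using assms by (simp add: phi_eq_iff)
qed

lemma ad_pullback_mult_positive:
  assumes dist: "distinct [i, j, k, l]" and x: "x \<in> block i j" and y: "y \<in> block k l"
    and z: "a \<in> {i, k}" "b \<in> {j, l}" "u \<in> block a b"
  shows "ad_pullback (\<phi> x * \<phi> y) u = 0"
  by (rule ad_pullback_mult_eq_0)
     (use z dist block_in_derived_ring [OF _ x] block_in_derived_ring [OF _ y]
       block_in_derived_ring [OF _ z(3)] in \<open>auto intro: commutator_blocks_eq_0 [OF x z(3)] commutator_blocks_eq_0 [OF y z(3)]\<close>)

text \<open>
  Let \<open>v = D u\<close>. Then \<open>\<phi> v = \<phi> x \<phi> w\<close> with \<open>w = [y, u] \<in> A\<^sub>i\<^sub>l\<close>. The Leibniz rule confines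
  \<open>v\<close> to row \<open>i\<close>, and \<open>v\<close> commutes with the positive blocks. If \<open>e\<^sub>i\<close> lies in the ring, then
  \<open>h = e\<^sub>i - t\<close> has weight one on \<open>x\<close> and on \<open>w\<close>, hence weight two on \<open>v\<close>, whereas the
  weight of the off-diagonal part of row \<open>i\<close> is one. Otherwise the other three idempotents lie in the ring,
  and those at \<open>j\<close> and \<open>l\<close> have weight minus one on one factor and zero on the other.
\<close>

lemma ad_pullback_mult_row:
  assumes dist: "distinct [i, j, k, l]" and x: "x \<in> block i j" and y: "y \<in> block k l"
    and u: "u \<in> block i k"
  shows "ad_pullback (\<phi> x * \<phi> y) u = 0"
proof -
  define D where "D = ad_pullback (\<phi> x * \<phi> y)"
  have D: "lie_derivation D"
    by (simp add: D_def lie_derivation_ad_pullback)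
  have kill: "D z = 0" if "a \<in> {i, k}" "b \<in> {j, l}" "z \<in> block a b" for a b z
    unfolding D_def using ad_pullback_mult_positive [OF dist x y that] .
  define v where "v = D u"
  define w where "w = commutator y u"
  have in_L: "x \<in> derived_ring" "y \<in> derived_ring" "u \<in> derived_ring"
    using block_in_derived_ring x y u dist by auto
  have w_eq: "w = - (u * y)"
    using block_mult_eq_0 [OF y u] dist by (auto simp: w_def commutator_def)
  then have w: "w \<in> block i l"
    using block_uminus [OF block_mult [OF u y]] by simp
  have "commutator x u = 0"
    using commutator_blocks_eq_0 [OF x u] dist by auto
  then have phi_v: "\<phi> v = \<phi> x * \<phi> w"
    using phi_ad_pullback_mult [OF in_L] by (simp add: v_def D_def w_def)
  have v_L: "v \<in> derived_ring"
    by (simp add: v_def D_def ad_pullback_in)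
  have w_L: "w \<in> derived_ring"
    by (simp add: w_def)
  \<comment> \<open>Factor \<open>u\<close> through \<open>l\<close> and through \<open>j\<close>: what remains outside row \<open>i\<close> would lie
    in column \<open>l\<close> and in column \<open>j\<close>.\<close>
  have row: "component p q v = 0" if "p \<noteq> i" for p q
  proof (cases "q = l")
    case True
    show ?thesis
      unfolding v_def
      by (rule component_derivation_left [OF D _ _ u, of j]) (use kill that True dist in auto)
  next
    case False
    show ?thesis
      unfolding v_def
      by (rule component_derivation_left [OF D _ _ u, of l]) (use kill that False dist in auto)
  qed
  have comm: "component p q (z * v) = component p q (v * z)" if "a \<in> {i, k}" "b \<in> {j, l}" "z \<in> block a b" for a b z p q
  proof -
    have "commutator z (D u) = 0"
      by (rule positive_derivation_block_commutes [OF D dist kill _ that]) (use u in auto)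
    then show ?thesis
      by (simp add: v_def commutator_def)
  qed
  have ii: "component i i v * z = 0" if "z \<in> block i j" for z
    using comm [OF _ _ that, of i j] row dist by (auto simp: component_mult_left [OF that] component_mult_right [OF that])
  have ik: "component i k v * z = 0" if "z \<in> block k j" for z
    using comm [OF _ _ that, of i j] dist by (auto simp: component_mult_left [OF that] component_mult_right [OF that])
  have ikt: "component i k v * t = 0" if "t \<in> block k k" for t
    using right_cancel_extend [OF component_in_block ik that] .
  have "component i q v = 0" for q
  proof (cases "has_unit i")
    case True
    obtain h t where h: "h \<in> derived_ring" "t \<in> block k k"
      "\<And>a. commutator h a = lm i a - rm i a - (t * a - a * t)"
      by (rule commutator_lm_rm [OF True, of k]) (use dist in auto)
    have hx: "commutator h x = x" and hw: "commutator h w = w"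
      unfolding h(3) weight_block [OF h(2) x] weight_block [OF h(2) w]
      using dist weight_block [OF h(2) x, of i] weight_block [OF h(2) w, of i] by auto
    have "commutator h v = v + v"
      by (rule commutator_eq_if_phi_mult [OF h(1) in_L(1) w_L v_L _ phi_v])
         (simp_all add: hx hw phi_v phi_add v_L derived_ring_add)
    \<comment> \<open>On the left, \<open>h\<close> multiplies \<open>(i, j)\<close> and \<open>(i, l)\<close> by one; on \<open>(i, k)\<close> the correction
      by \<open>t\<close> drops out.\<close>
    then have *: "component i q (commutator h v) = component i q v + component i q v" for q
      by (simp add: component_add)
    have "component i i v = 0"
      by (rule right_cancel [OF True component_in_block ii])
    then show ?thesis
      using *[of q] ikt [OF h(2)] dist
      by (cases q rule: idx_cases_distinct [OF dist]) (auto simp: h(3) component_weight [OF h(2)])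
  next
    case False
    then have unit: "has_unit j" "has_unit k" "has_unit l"
      using has_unit_or [of i] dist by auto
    obtain h t where h: "h \<in> derived_ring" "t \<in> block k k"
      "\<And>a. commutator h a = lm j a - rm j a - (t * a - a * t)"
      by (rule commutator_lm_rm [OF unit(1), of k]) (use dist in auto)
    have hx: "commutator h x = - x" and hw: "commutator h w = 0"
      unfolding h(3) using dist weight_block [OF h(2) x, of j] weight_block [OF h(2) w, of j] by auto
    \<comment> \<open>The idempotent at \<open>j\<close> excludes all components but \<open>(i, j)\<close> and \<open>(i, k)\<close>, the one
      at \<open>l\<close> then excludes \<open>(i, j)\<close>, and the unit at \<open>k\<close> cancels the rest.\<close>
    have "commutator h v = - v"
      by (rule commutator_eq_if_phi_mult [OF h(1) in_L(1) w_L v_L _ phi_v])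
         (simp_all add: hx hw phi_v phi_uminus v_L in_L)
    then have *: "component i q (commutator h v) = - component i q v" for q
      by (simp add: component_uminus)
    obtain h' t' where h': "h' \<in> derived_ring" "t' \<in> block k k"
      "\<And>a. commutator h' a = lm l a - rm l a - (t' * a - a * t')"
      by (rule commutator_lm_rm [OF unit(3), of k]) (use dist in auto)
    have hx: "commutator h' x = 0" and hw: "commutator h' w = - w"
      unfolding h'(3) using dist weight_block [OF h'(2) x, of l] weight_block [OF h'(2) w, of l] by auto
    have "commutator h' v = - v"
      by (rule commutator_eq_if_phi_mult [OF h'(1) in_L(1) w_L v_L _ phi_v])
         (simp_all add: hx hw phi_v phi_uminus v_L w_L)
    then have **: "component i q (commutator h' v) = - component i q v" for q
      by (simp add: component_uminus)
    have "component i k v = 0"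
      by (rule right_cancel [OF unit(2) component_in_block ik])
    then show ?thesis
      using *[of q] **[of q] dist
      by (cases q rule: idx_cases_distinct [OF dist])
         (auto simp: h(3) h'(3) component_weight [OF h(2)] component_weight [OF h'(2)])
  qed
  then have "v = 0"
    using row eq_0_if_components_eq_0 by metis
  then show ?thesis
    by (simp add: v_def D_def)
qed

text \<open>
  The transpose of the preceding argument: here \<open>\<phi> v = \<phi> w \<phi> y\<close> with \<open>w = [x, u] \<in> A\<^sub>i\<^sub>l\<close>,
  and \<open>v\<close> lies in column \<open>l\<close>.
\<close>

lemma ad_pullback_mult_column:
  assumes dist: "distinct [i, j, k, l]" and x: "x \<in> block i j" and y: "y \<in> block k l"
    and u: "u \<in> block j l"
  shows "ad_pullback (\<phi> x * \<phi> y) u = 0"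
proof -
  define D where "D = ad_pullback (\<phi> x * \<phi> y)"
  have D: "lie_derivation D"
    by (simp add: D_def lie_derivation_ad_pullback)
  have kill: "D z = 0" if "a \<in> {i, k}" "b \<in> {j, l}" "z \<in> block a b" for a b z
    unfolding D_def using ad_pullback_mult_positive [OF dist x y that] .
  define v where "v = D u"
  define w where "w = commutator x u"
  have in_L: "x \<in> derived_ring" "y \<in> derived_ring" "u \<in> derived_ring"
    using block_in_derived_ring x y u dist by auto
  have w_eq: "w = x * u"
    using block_mult_eq_0 [OF u x] dist by (auto simp: w_def commutator_def)
  then have w: "w \<in> block i l"
    using block_mult [OF x u] by simp
  have "commutator y u = 0"
    using commutator_blocks_eq_0 [OF y u] dist by auto
  then have phi_v: "\<phi> v = \<phi> w * \<phi> y"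
    using phi_ad_pullback_mult [OF in_L] by (simp add: v_def D_def w_def)
  have v_L: "v \<in> derived_ring"
    by (simp add: v_def D_def ad_pullback_in)
  have w_L: "w \<in> derived_ring"
    by (simp add: w_def)
  \<comment> \<open>Factor \<open>u\<close> through \<open>k\<close> and through \<open>i\<close>.\<close>
  have col: "component p q v = 0" if "q \<noteq> l" for p q
  proof (cases "p = i")
    case True
    show ?thesis
      unfolding v_def
      by (rule component_derivation_right [OF D _ _ u, of k]) (use kill that True dist in auto)
  next
    case False
    show ?thesis
      unfolding v_def
      by (rule component_derivation_right [OF D _ _ u, of i]) (use kill that False dist in auto)
  qed
  have comm: "component p q (z * v) = component p q (v * z)" if "a \<in> {i, k}" "b \<in> {j, l}" "z \<in> block a b" for a b z p q
  proof -
    have "commutator z (D u) = 0"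
      by (rule positive_derivation_block_commutes [OF D dist kill _ that]) (use u in auto)
    then show ?thesis
      by (simp add: v_def commutator_def)
  qed
  have ll: "z * component l l v = 0" if "z \<in> block k l" for z
    using comm [OF _ _ that, of k l] col dist by (auto simp: component_mult_left [OF that] component_mult_right [OF that])
  have jl: "z * component j l v = 0" if "z \<in> block i j" for z
    using comm [OF _ _ that, of i l] dist by (auto simp: component_mult_left [OF that] component_mult_right [OF that])
  have jlt: "t * component j l v = 0" if "t \<in> block j j" for t
    using left_cancel_extend [OF component_in_block jl that] .
  have "component p l v = 0" for p
  proof (cases "has_unit l")
    case True
    obtain h t where h: "h \<in> derived_ring" "t \<in> block j j"
      "\<And>a. commutator h a = lm l a - rm l a - (t * a - a * t)"
      by (rule commutator_lm_rm [OF True, of j]) (use dist in auto)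
    have hw: "commutator h w = - w" and hy: "commutator h y = - y"
      unfolding h(3) using dist weight_block [OF h(2) w, of l] weight_block [OF h(2) y, of l] by auto
    have "commutator h v = - (v + v)"
      by (rule commutator_eq_if_phi_mult [OF h(1) w_L in_L(2) v_L _ phi_v])
         (simp_all add: hw hy phi_v phi_add phi_diff phi_uminus in_L w_L v_L derived_ring_add derived_ring_diff)
    then have *: "component p l (commutator h v) = - (component p l v + component p l v)" for p
      by (simp add: component_add component_diff component_uminus)
    have "component l l v = 0"
      by (rule left_cancel [OF True component_in_block ll])
    then show ?thesis
      using *[of p] jlt [OF h(2)] dist
      by (cases p rule: idx_cases_distinct [OF dist]) (auto simp: h(3) component_weight [OF h(2)])
  next
    case False
    then have unit: "has_unit i" "has_unit j" "has_unit k"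
      using has_unit_or [of l] dist by auto
    obtain h t where h: "h \<in> derived_ring" "t \<in> block j j"
      "\<And>a. commutator h a = lm i a - rm i a - (t * a - a * t)"
      by (rule commutator_lm_rm [OF unit(1), of j]) (use dist in auto)
    have hw: "commutator h w = w" and hy: "commutator h y = 0"
      unfolding h(3) using dist weight_block [OF h(2) w, of i] weight_block [OF h(2) y, of i] by auto
    have "commutator h v = v"
      by (rule commutator_eq_if_phi_mult [OF h(1) w_L in_L(2) v_L _ phi_v])
         (simp_all add: hw hy phi_v v_L)
    then have *: "component p l (commutator h v) = component p l v" for p
      by simp
    obtain h' t' where h': "h' \<in> derived_ring" "t' \<in> block j j"
      "\<And>a. commutator h' a = lm k a - rm k a - (t' * a - a * t')"
      by (rule commutator_lm_rm [OF unit(3), of j]) (use dist in auto)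
    have hw: "commutator h' w = 0" and hy: "commutator h' y = y"
      unfolding h'(3) using dist weight_block [OF h'(2) w, of k] weight_block [OF h'(2) y, of k] by auto
    have "commutator h' v = v"
      by (rule commutator_eq_if_phi_mult [OF h'(1) w_L in_L(2) v_L _ phi_v])
         (simp_all add: hw hy phi_v v_L)
    then have **: "component p l (commutator h' v) = component p l v" for p
      by simp
    have "component j l v = 0"
      by (rule left_cancel [OF unit(2) component_in_block jl])
    then show ?thesis
      using *[of p] **[of p] dist
      by (cases p rule: idx_cases_distinct [OF dist])
         (auto simp: h(3) h'(3) component_weight [OF h(2)] component_weight [OF h'(2)])
  qed
  then have "v = 0"
    using col eq_0_if_components_eq_0 by metis
  then show ?thesis
    by (simp add: v_def D_def)
qed

lemma phi_mult_commute:
  assumes "x \<in> derived_ring" "y \<in> derived_ring" "commutator x y = 0"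
  shows "\<phi> x * \<phi> y = \<phi> y * \<phi> x"
proof -
  have "commutator (\<phi> x) (\<phi> y) = 0"
    using phi_commutator [OF assms(1,2)] assms(3) by simp
  then show ?thesis
    by (simp add: commutator_def)
qed

lemma phi_mult_central:
  assumes dist: "distinct [i, j, k, l]" and x: "x \<in> block i j" and y: "y \<in> block k l"
    and u: "u \<in> derived_ring"
  shows "commutator (\<phi> x * \<phi> y) (\<phi> u) = 0"
proof -
  have swap: "\<phi> x * \<phi> y = \<phi> y * \<phi> x"
    using block_in_derived_ring [OF _ x] block_in_derived_ring [OF _ y] commutator_blocks_eq_0 [OF x y] dist
    by (intro phi_mult_commute) auto
  have dist': "distinct [k, l, i, j]"
    using dist by auto
  have "ad_pullback (\<phi> x * \<phi> y) u = 0"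
  proof (rule derivation_eq_0 [OF lie_derivation_ad_pullback dist _ u])
    fix a b v
    assume ab: "a \<noteq> b" "\<not> (a \<in> {j, l} \<and> b \<in> {i, k})" and v: "v \<in> block a b"
    consider "a \<in> {i, k}" "b \<in> {j, l}" | "a = i" "b = k" | "a = k" "b = i" | "a = j" "b = l" | "a = l" "b = j"
      using ab by (cases a rule: idx_cases_distinct [OF dist]; cases b rule: idx_cases_distinct [OF dist]) auto
    then show "ad_pullback (\<phi> x * \<phi> y) v = 0"
    proof cases
      case 1
      then show ?thesis
        using ad_pullback_mult_positive [OF dist x y _ _ v] by blast
    next
      case 2
      then show ?thesis
        using ad_pullback_mult_row [OF dist x y] v by blast
    next
      case 3
      then show ?thesis
        using ad_pullback_mult_row [OF dist' y x] v swap by simp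
    next
      case 4
      then show ?thesis
        using ad_pullback_mult_column [OF dist x y] v by blast
    next
      case 5
      then show ?thesis
        using ad_pullback_mult_column [OF dist' y x] v swap by simp
    qed
  qed
  then show ?thesis
    using phi_ad_pullback [of "\<phi> x * \<phi> y" u] by simp
qed

text \<open>
  Apply the derivation of a product \<open>X Y\<close> with \<open>X \<in> M\<^sub>i\<^sub>j\<close>, \<open>Y \<in> M\<^sub>k\<^sub>l\<close> to \<open>m \<in> A\<^sub>i\<^sub>k\<close>.
  Since \<open>X\<close> commutes with \<open>\<phi> m\<close>, centrality reads \<open>X [Y, \<phi> m] = 0\<close>, and the elements
  \<open>[y, m]\<close> span \<open>A\<^sub>i\<^sub>l\<close>.
\<close>

lemma phi_mult_same_row:
  assumes "j \<noteq> l" "i \<noteq> j" "i \<noteq> l" and x: "x \<in> block i j" and v: "v \<in> block i l"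
  shows "\<phi> x * \<phi> v = 0"
proof -
  obtain k where k: "k \<noteq> i" "k \<noteq> j" "k \<noteq> l"
    by (rule ex_idx_avoiding)
  have dist: "distinct [i, j, k, l]"
    using assms k by auto
  have L: "w \<in> derived_ring" if "w \<in> block a b" "a \<noteq> b" for w a b
    using that block_in_derived_ring by blast
  show ?thesis
    using v
  proof (induction rule: block_induct [where j = k])
    case (diff a b)
    then show ?case
      using L assms by (simp add: phi_diff right_diff_distrib)
  next
    case (mult m y)
    have L': "x \<in> derived_ring" "m \<in> derived_ring" "y \<in> derived_ring" "m * y \<in> derived_ring"
      using L [OF x] L [OF mult(1)] L [OF mult(2)] L [OF block_mult [OF mult]] dist by auto
    have "commutator x m = 0" "commutator y m = - (m * y)"
      using commutator_blocks_eq_0 [OF x mult(1)] commutator_blocks_chain [OF mult] dist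
      by (auto simp: commutator_def)
    then have "\<phi> (ad_pullback (\<phi> x * \<phi> y) m) = - (\<phi> x * \<phi> (m * y))"
      using phi_ad_pullback_mult [of x y m] L' by (simp add: phi_uminus)
    then show ?case
      using phi_mult_central [OF dist x mult(2) L'(2)] by (simp add: phi_ad_pullback)
  qed simp
qed

lemma phi_mult_same_column:
  assumes "i \<noteq> k" "i \<noteq> l" "k \<noteq> l" and v: "v \<in> block i l" and y: "y \<in> block k l"
  shows "\<phi> v * \<phi> y = 0"
proof -
  obtain j where j: "j \<noteq> i" "j \<noteq> k" "j \<noteq> l"
    by (rule ex_idx_avoiding)
  have dist: "distinct [i, j, k, l]"
    using assms j by auto
  have L: "w \<in> derived_ring" if "w \<in> block a b" "a \<noteq> b" for w a b
    using that block_in_derived_ring by blast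
  show ?thesis
    using v
  proof (induction rule: block_induct [where j = j])
    case (diff a b)
    then show ?case
      using L assms by (simp add: phi_diff left_diff_distrib)
  next
    case (mult x m)
    have L': "x \<in> derived_ring" "m \<in> derived_ring" "y \<in> derived_ring"
      using L [OF y] L [OF mult(1)] L [OF mult(2)] dist by auto
    have "commutator y m = 0" "commutator x m = x * m"
      using commutator_blocks_eq_0 [OF y mult(2)] commutator_blocks_chain [OF mult] dist by auto
    then have "\<phi> (ad_pullback (\<phi> x * \<phi> y) m) = \<phi> (x * m) * \<phi> y"
      using phi_ad_pullback_mult [of x y m] L' by simp
    then show ?case
      using phi_mult_central [OF dist mult(1) y L'(2)] by (simp add: phi_ad_pullback)
  qed simp
qed

lemma phi_chain:
  assumes "x \<in> block i j" "y \<in> block j k" "distinct [i, j, k]"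
  shows "\<phi> (x * y) = \<phi> x * \<phi> y - \<phi> y * \<phi> x"
proof -
  have "\<phi> (commutator x y) = commutator (\<phi> x) (\<phi> y)"
    using assms block_in_derived_ring [of i j x] block_in_derived_ring [of j k y] by (simp add: phi_commutator)
  then show ?thesis
    using commutator_blocks_chain [OF assms(1,2)] assms(3) by (simp add: commutator_def [of "\<phi> x"])
qed

text \<open>
  Write the second factor as \<open>[a, b]\<close> with \<open>a \<in> A\<^sub>i\<^sub>k\<close> and \<open>b \<in> A\<^sub>k\<^sub>j\<close>: the first factor kills
  \<open>\<phi> a\<close> by the row relation and \<open>\<phi> b\<close> by the column relation.
\<close>

lemma phi_mult_same_block:
  assumes "i \<noteq> j" and x: "x \<in> block i j" and v: "v \<in> block i j"
  shows "\<phi> x * \<phi> v = 0"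
proof -
  obtain k where k: "k \<noteq> i" "k \<noteq> j" "k \<noteq> j"
    by (rule ex_idx_avoiding)
  show ?thesis
    using v
  proof (induction rule: block_induct [where j = k])
    case (diff a b)
    then show ?case
      using block_in_derived_ring [OF \<open>i \<noteq> j\<close>] by (simp add: phi_diff right_diff_distrib)
  next
    case (mult a b)
    have "\<phi> x * \<phi> a = 0"
      using k assms by (intro phi_mult_same_row [OF _ _ _ x mult(1)]) auto
    moreover have "\<phi> x * \<phi> b = 0"
      using k assms by (intro phi_mult_same_column [OF _ _ _ x mult(2)]) auto
    moreover have "\<phi> (a * b) = \<phi> a * \<phi> b - \<phi> b * \<phi> a"
      using k assms by (intro phi_chain [OF mult]) auto
    ultimately show ?case
      by (simp add: right_diff_distrib flip: mult.assoc)
  qed simp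
qed

text \<open>
  The product is central and, by the relation within a single block, kills \<open>M\<^sub>i\<^sub>j\<close>. The
  elements killed by a central element form a Lie ideal, so the product annihilates everything.
\<close>

lemma phi_mult_distinct:
  assumes dist: "distinct [i, j, k, l]" and x: "x \<in> block i j" and y: "y \<in> block k l"
  shows "\<phi> x * \<phi> y = 0"
proof (rule subring_B_eq_0)
  have xy: "x \<in> derived_ring" "y \<in> derived_ring"
    using block_in_derived_ring x y dist by auto
  show "\<phi> x * \<phi> y \<in> subring_B"
    using xy by (simp add: subring_B_mult phi_in_subring_B)
  have swap: "\<phi> x * \<phi> y = \<phi> y * \<phi> x"
    using xy commutator_blocks_eq_0 [OF x y] dist by (intro phi_mult_commute) auto
  fix a b u
  assume ab: "a \<noteq> b" and u: "u \<in> block a b"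
  have central: "\<phi> x * \<phi> y * \<phi> w = \<phi> w * (\<phi> x * \<phi> y)" if "w \<in> derived_ring" for w
    using phi_mult_central [OF dist x y that] by (simp add: commutator_def)
  have "\<phi> x * \<phi> y * \<phi> u = 0"
  proof (rule off_diagonal_in_lie_ideal [of i j "\<lambda>u. \<phi> x * \<phi> y * \<phi> u = 0", OF _ _ _ _ ab u])
    show "\<phi> x * \<phi> y * \<phi> w = 0" if "w \<in> block i j" for w
      using phi_mult_same_block [OF _ x that] dist by (auto simp: swap mult.assoc)
    show "\<phi> x * \<phi> y * \<phi> (v - w) = 0"
      if "v \<in> derived_ring" "w \<in> derived_ring" "\<phi> x * \<phi> y * \<phi> v = 0" "\<phi> x * \<phi> y * \<phi> w = 0" for v w
      using that by (simp add: phi_diff right_diff_distrib)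
    show "\<phi> x * \<phi> y * \<phi> (commutator v w) = 0"
      if "v \<in> derived_ring" "w \<in> derived_ring" "\<phi> x * \<phi> y * \<phi> v = 0" for v w
    proof -
      have "\<phi> x * \<phi> y * (\<phi> v * \<phi> w) = (\<phi> x * \<phi> y * \<phi> v) * \<phi> w"
        by (simp add: mult.assoc)
      moreover have "\<phi> x * \<phi> y * (\<phi> w * \<phi> v) = \<phi> w * (\<phi> x * \<phi> y * \<phi> v)"
        using central [OF that(2)] by (metis mult.assoc)
      ultimately show ?thesis
        using that by (simp add: phi_commutator commutator_def [of "\<phi> v"] right_diff_distrib)
    qed
  qed (use dist in auto)
  then show "\<phi> x * \<phi> y * \<phi> u = 0 \<and> \<phi> u * (\<phi> x * \<phi> y) = 0"
    using central block_in_derived_ring [OF ab u] by simp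
qed

lemma phi_mult_eq_0:
  assumes x: "x \<in> block i j" and y: "y \<in> block k l" and "i \<noteq> j" "k \<noteq> l" "j \<noteq> k" "i \<noteq> l"
  shows "\<phi> x * \<phi> y = 0"
proof (cases "i = k")
  case True
  then show ?thesis
    using assms phi_mult_same_row [of j l i x y] phi_mult_same_block [of i j x y] by (cases "j = l") auto
next
  case False
  then show ?thesis
    using assms phi_mult_same_column [of i k l x y] phi_mult_distinct [OF _ x y] by (cases "j = l") auto
qed

end

section \<open>Splitting the generated subring into two orthogonal ideals\<close>

context lie_iso
begin

text \<open>
  The values \<open>\<psi>\<^sub>1 (x y)\<close> of the homomorphism that is to be constructed.
\<close>

definition forward_products :: "'b set"
  where "forward_products = {\<phi> x * \<phi> y | x y i j k. distinct [i, j, k] \<and> x \<in> block i j \<and> y \<in> block j k}"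

text \<open>
  The values \<open>\<psi>\<^sub>2 (x y)\<close> of the anti-homomorphism that is to be constructed.
\<close>

definition backward_products :: "'b set"
  where "backward_products = {\<phi> y * \<phi> x | x y i j k. distinct [i, j, k] \<and> x \<in> block i j \<and> y \<in> block j k}"

abbreviation "forward_ring \<equiv> generated_subring forward_products"
abbreviation "backward_ring \<equiv> generated_subring backward_products"

text \<open>
  The next four lemmas are the words of length three that vanish although neither pair of
  adjacent letters need do so: replacing a product of two letters by the opposite product plus a
  single letter produces adjacent pairs that vanish.
\<close>

lemma phi_reversed_tail:
  assumes "distinct [j, k, r]" "p \<noteq> k" "p \<noteq> r" "y \<in> block j k" "z \<in> block k r" "w \<in> block p k"
  shows "\<phi> y * (\<phi> z * \<phi> w) = 0"
proof -
  have "\<phi> y * \<phi> z = \<phi> (y * z) + \<phi> z * \<phi> y"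
    using phi_chain [OF assms(4,5,1)] by simp
  moreover have "\<phi> (y * z) * \<phi> w = 0"
    using assms by (intro phi_mult_eq_0 [OF block_mult [OF assms(4,5)] assms(6)]) auto
  moreover have "\<phi> y * \<phi> w = 0"
    using assms by (intro phi_mult_eq_0 [OF assms(4,6)]) auto
  ultimately show ?thesis
    by (simp add: distrib_right mult.assoc flip: mult.assoc [of "\<phi> y" "\<phi> z" "\<phi> w"])
qed

lemma phi_chain_tail:
  assumes "distinct [i, j, k]" "q \<noteq> j" "q \<noteq> k" "x \<in> block i j" "y \<in> block j k" "z \<in> block q j"
  shows "\<phi> x * (\<phi> y * \<phi> z) = 0"
proof -
  have "\<phi> x * \<phi> y = \<phi> (x * y) + \<phi> y * \<phi> x"
    using phi_chain [OF assms(4,5,1)] by simp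
  moreover have "\<phi> (x * y) * \<phi> z = 0"
    using assms by (intro phi_mult_eq_0 [OF block_mult [OF assms(4,5)] assms(6)]) auto
  moreover have "\<phi> x * \<phi> z = 0"
    using assms by (intro phi_mult_eq_0 [OF assms(4,6)]) auto
  ultimately show ?thesis
    by (simp add: distrib_right mult.assoc flip: mult.assoc [of "\<phi> x" "\<phi> y" "\<phi> z"])
qed

lemma phi_chain_head:
  assumes "distinct [i, j, k]" "q \<noteq> j" "q \<noteq> i" "w \<in> block j q" "x \<in> block i j" "y \<in> block j k"
  shows "\<phi> w * (\<phi> x * \<phi> y) = 0"
proof -
  have "\<phi> x * \<phi> y = \<phi> (x * y) + \<phi> y * \<phi> x"
    using phi_chain [OF assms(5,6,1)] by simp
  moreover have "\<phi> w * \<phi> (x * y) = 0"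
    using assms by (intro phi_mult_eq_0 [OF assms(4) block_mult [OF assms(5,6)]]) auto
  moreover have "\<phi> w * \<phi> y = 0"
    using assms by (intro phi_mult_eq_0 [OF assms(4,6)]) auto
  ultimately show ?thesis
    by (simp add: distrib_left flip: mult.assoc)
qed

lemma phi_reversed_head:
  assumes "distinct [p, i, r]" "i \<noteq> j" "p \<noteq> j" "z \<in> block i r" "w \<in> block p i" "x \<in> block i j"
  shows "\<phi> z * (\<phi> w * \<phi> x) = 0"
proof -
  have "\<phi> z * \<phi> w = \<phi> w * \<phi> z - \<phi> (w * z)"
    using phi_chain [OF assms(5,4,1)] by simp
  moreover have "\<phi> (w * z) * \<phi> x = 0"
    using assms by (intro phi_mult_eq_0 [OF block_mult [OF assms(5,4)] assms(6)]) auto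
  moreover have "\<phi> z * \<phi> x = 0"
    using assms by (intro phi_mult_eq_0 [OF assms(4,6)]) auto
  ultimately show ?thesis
    by (simp add: left_diff_distrib mult.assoc flip: mult.assoc [of "\<phi> z" "\<phi> w" "\<phi> x"])
qed

text \<open>
  In a word of four letters, only the two inner ones matter at first. If they do not vanish, one
  or both of the pairs of indices where they meet coincide; one coincidence leaves a vanishing
  word of length three, and two coincidences are removed by exchanging the two letters of the first factor.
\<close>

lemma forward_backward_products_eq_0:
  assumes "s \<in> forward_products" "t \<in> backward_products"
  shows "s * t = 0"
proof -
  obtain x y i j k where 1: "s = \<phi> x * \<phi> y" "distinct [i, j, k]" "x \<in> block i j" "y \<in> block j k"
    using assms(1) by (auto simp: forward_products_def)
  obtain w z p q r where 2: "t = \<phi> z * \<phi> w" "distinct [p, q, r]" "w \<in> block p q" "z \<in> block q r"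
    using assms(2) by (auto simp: backward_products_def)
  consider "k \<noteq> q" "j \<noteq> r" | "k \<noteq> q" "j = r" | "k = q" "j \<noteq> r" | "k = q" "j = r"
    by blast
  then show ?thesis
  proof cases
    case ne: 1
    have "\<phi> y * \<phi> z = 0"
      using 1 2 ne by (intro phi_mult_eq_0 [OF 1(4) 2(4)]) auto
    then have "\<phi> x * (\<phi> y * \<phi> z) * \<phi> w = 0"
      by simp
    then show ?thesis
      by (simp add: 1 2 mult.assoc)
  next
    case ne: 2
    have "\<phi> x * (\<phi> y * \<phi> z) = 0"
      using 1 2 ne by (intro phi_chain_tail [of i j k q]) auto
    then have "\<phi> x * (\<phi> y * \<phi> z) * \<phi> w = 0"
      by simp
    then show ?thesis
      by (simp add: 1 2 mult.assoc)
  next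
    case 3
    have "\<phi> y * (\<phi> z * \<phi> w) = 0"
      using 1 2 3 by (intro phi_reversed_tail [of j k r p]) auto
    then show ?thesis
      by (simp add: 1 2 mult.assoc)
  next
    \<comment> \<open>Both pairs of indices meet: exchange the first two letters.\<close>
    case 4
    have "\<phi> x * \<phi> y = \<phi> (x * y) + \<phi> y * \<phi> x"
      using phi_chain [OF 1(3,4,2)] by simp
    moreover have "\<phi> (x * y) * (\<phi> z * \<phi> w) = 0"
      using 1 2 4 block_mult [OF 1(3,4)] by (intro phi_reversed_tail [of i k r p]) auto
    moreover have "\<phi> x * \<phi> z = 0"
      using 1 2 4 by (intro phi_mult_eq_0 [OF 1(3) 2(4)]) auto
    then have "\<phi> x * (\<phi> z * \<phi> w) = 0"
      by (simp flip: mult.assoc)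
    ultimately show ?thesis
      by (simp add: 1 2 distrib_right mult.assoc)
  qed
qed

lemma backward_forward_products_eq_0:
  assumes "s \<in> forward_products" "t \<in> backward_products"
  shows "t * s = 0"
proof -
  obtain x y i j k where 1: "s = \<phi> x * \<phi> y" "distinct [i, j, k]" "x \<in> block i j" "y \<in> block j k"
    using assms(1) by (auto simp: forward_products_def)
  obtain w z p q r where 2: "t = \<phi> z * \<phi> w" "distinct [p, q, r]" "w \<in> block p q" "z \<in> block q r"
    using assms(2) by (auto simp: backward_products_def)
  consider "q \<noteq> i" "p \<noteq> j" | "q \<noteq> i" "p = j" | "q = i" "p \<noteq> j" | "q = i" "p = j"
    by blast
  then show ?thesis
  proof cases
    case ne: 1
    have "\<phi> w * \<phi> x = 0"
      using 1 2 ne by (intro phi_mult_eq_0 [OF 2(3) 1(3)]) auto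
    then have "\<phi> z * (\<phi> w * \<phi> x) * \<phi> y = 0"
      by simp
    then show ?thesis
      by (simp add: 1 2 mult.assoc)
  next
    case ne: 2
    have "\<phi> w * (\<phi> x * \<phi> y) = 0"
      using 1 2 ne by (intro phi_chain_head [of i j k q]) auto
    then show ?thesis
      by (simp add: 1 2 mult.assoc)
  next
    case 3
    have "\<phi> z * (\<phi> w * \<phi> x) = 0"
      using 1 2 3 by (intro phi_reversed_head [of p i r j]) auto
    then have "\<phi> z * (\<phi> w * \<phi> x) * \<phi> y = 0"
      by simp
    then show ?thesis
      by (simp add: 1 2 mult.assoc)
  next
    \<comment> \<open>Both pairs of indices meet: exchange the last two letters.\<close>
    case 4
    have "\<phi> x * \<phi> y = \<phi> (x * y) + \<phi> y * \<phi> x"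
      using phi_chain [OF 1(3,4,2)] by simp
    moreover have "\<phi> z * (\<phi> w * \<phi> (x * y)) = 0"
      using 1 2 4 block_mult [OF 1(3,4)] by (intro phi_reversed_head [of p i r k]) auto
    moreover have "\<phi> w * \<phi> y = 0"
      using 1 2 4 by (intro phi_mult_eq_0 [OF 2(3) 1(4)]) auto
    then have "\<phi> w * (\<phi> y * \<phi> x) = 0"
      by (simp flip: mult.assoc)
    ultimately show ?thesis
      by (simp add: 1 2 distrib_left mult.assoc)
  qed
qed

lemma forward_backward_eq_0: "a \<in> forward_ring \<Longrightarrow> b \<in> backward_ring \<Longrightarrow> a * b = 0"
  by (rule generated_subring_mult_eq_0) (auto intro: forward_backward_products_eq_0)

lemma backward_forward_eq_0: "b \<in> backward_ring \<Longrightarrow> a \<in> forward_ring \<Longrightarrow> b * a = 0"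
  by (rule generated_subring_mult_eq_0) (auto intro: backward_forward_products_eq_0)

lemma parts_subset: "forward_ring \<subseteq> subring_B" "backward_ring \<subseteq> subring_B"
proof -
  have "\<phi> x * \<phi> y \<in> subring_B" "\<phi> y * \<phi> x \<in> subring_B"
    if "distinct [i, j, k]" "x \<in> block i j" "y \<in> block j k" for x y i j k
    using that block_in_derived_ring [of i j x] block_in_derived_ring [of j k y]
    by (simp_all add: subring_B_mult phi_in_subring_B)
  then have "forward_products \<subseteq> subring_B" "backward_products \<subseteq> subring_B"
    unfolding forward_products_def backward_products_def by blast+
  then show "forward_ring \<subseteq> subring_B" "backward_ring \<subseteq> subring_B"
    by (simp_all add: generated_subring_subset is_subring_B)
qed

lemmas part_zero = subring_zero [OF is_subring_generated_subring]
lemmas part_diff = subring_diff [OF is_subring_generated_subring]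
lemmas part_mult = subring_mult [OF is_subring_generated_subring]

lemma phi_chain_in_parts:
  assumes "distinct [i, j, k]" "x \<in> block i j" "y \<in> block j k"
  shows "\<phi> x * \<phi> y \<in> forward_ring" "\<phi> y * \<phi> x \<in> backward_ring"
  unfolding forward_products_def backward_products_def using assms by (blast intro: generated_subring_inc)+

text \<open>
  The two summands come from \<open>\<phi> (x y) = \<phi> x \<phi> y - \<phi> y \<phi> x\<close>.
\<close>

lemma phi_split:
  assumes "i \<noteq> k" "u \<in> block i k"
  shows "\<exists>b\<in>forward_ring. \<phi> u - b \<in> backward_ring"
proof -
  obtain j where j: "j \<noteq> i" "j \<noteq> k" "j \<noteq> k"
    by (rule ex_idx_avoiding)
  show ?thesis
    using assms(2)
  proof (induction rule: block_induct [where j = j])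
    case zero
    then show ?case
      using part_zero by (intro bexI [of _ 0]) auto
  next
    case (diff x y)
    then obtain b c where bc: "b \<in> forward_ring" "c \<in> forward_ring" "\<phi> x - b \<in> backward_ring" "\<phi> y - c \<in> backward_ring"
      by blast
    have "\<phi> (x - y) - (b - c) = (\<phi> x - b) - (\<phi> y - c)"
      using diff assms block_in_derived_ring [OF assms(1)] by (simp add: phi_diff)
    then have "\<phi> (x - y) - (b - c) \<in> backward_ring"
      using part_diff [OF bc(3,4)] by (simp only:)
    then show ?case
      using part_diff [OF bc(1,2)] by blast
  next
    case (mult x y)
    have "distinct [i, j, k]"
      using j assms by auto
    from phi_chain [OF mult this] phi_chain_in_parts [OF this mult] show ?case
      using part_diff [OF part_zero, of "\<phi> y * \<phi> x" backward_products] by (intro bexI [of _ "\<phi> x * \<phi> y"]) auto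
  qed
qed

lemma eq_0_if_annihilates_parts:
  assumes "c \<in> subring_B" "\<And>b. b \<in> forward_ring \<or> b \<in> backward_ring \<Longrightarrow> c * b = 0 \<and> b * c = 0"
  shows "c = 0"
proof (rule subring_B_eq_0 [OF assms(1)])
  fix i j u
  assume "i \<noteq> j" "u \<in> block i j"
  then obtain b where "b \<in> forward_ring" "\<phi> u - b \<in> backward_ring"
    using phi_split by blast
  then have "c * b + c * (\<phi> u - b) = 0" "b * c + (\<phi> u - b) * c = 0"
    using assms(2) by auto
  then show "c * \<phi> u = 0 \<and> \<phi> u * c = 0"
    by (simp add: algebra_simps)
qed

lemma forward_Int_backward:
  assumes "c \<in> forward_ring" "c \<in> backward_ring"
  shows "c = 0"
  using assms parts_subset forward_backward_eq_0 backward_forward_eq_0 by (intro eq_0_if_annihilates_parts) auto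

text \<open>
  Meaningful on off-diagonal elements, where the two components of \<open>\<phi> u\<close> exist and are unique.
\<close>

definition phi1 :: "'a \<Rightarrow> 'b"
  where "phi1 u = (THE b. b \<in> forward_ring \<and> \<phi> u - b \<in> backward_ring)"

lemma phi1_eq:
  assumes "b \<in> forward_ring" "\<phi> u - b \<in> backward_ring"
  shows "phi1 u = b"
  unfolding phi1_def
proof (rule the_equality)
  fix c assume c: "c \<in> forward_ring \<and> \<phi> u - c \<in> backward_ring"
  then have "c - b \<in> backward_ring"
    using part_diff [OF assms(2), of "\<phi> u - c"] by simp
  then show "c = b"
    using forward_Int_backward [of "c - b"] part_diff c assms(1) by auto
qed (use assms in simp)

text \<open>
  The negative of the component of \<open>\<phi> u\<close> in the second ring; without the sign it would reverse
  products only up to sign.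
\<close>

definition phi2 :: "'a \<Rightarrow> 'b"
  where "phi2 u = phi1 u - \<phi> u"

lemma phi_parts:
  assumes "i \<noteq> j" "u \<in> block i j"
  shows "phi1 u \<in> forward_ring" "phi2 u \<in> backward_ring"
proof -
  obtain b where b: "b \<in> forward_ring" "\<phi> u - b \<in> backward_ring"
    using phi_split [OF assms] by blast
  then show "phi1 u \<in> forward_ring" "phi2 u \<in> backward_ring"
    using phi1_eq [OF b] part_diff [OF part_zero b(2)] by (simp_all add: phi2_def)
qed

lemma phi_eq_parts: "\<phi> u = phi1 u - phi2 u"
  by (simp add: phi2_def)

lemma phi1_diff:
  assumes "i \<noteq> j" "u \<in> block i j" "v \<in> block i j"
  shows "phi1 (u - v) = phi1 u - phi1 v" "phi2 (u - v) = phi2 u - phi2 v"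
proof -
  have diff: "\<phi> (u - v) = \<phi> u - \<phi> v"
    using assms block_in_derived_ring by (simp add: phi_diff)
  have "\<phi> (u - v) - (phi1 u - phi1 v) = phi2 v - phi2 u"
    by (simp add: diff phi2_def)
  then have "\<phi> (u - v) - (phi1 u - phi1 v) \<in> backward_ring"
    using phi_parts(2) [OF assms(1)] assms by (simp add: part_diff)
  moreover have "phi1 u - phi1 v \<in> forward_ring"
    by (intro part_diff phi_parts(1) [OF assms(1)] assms(2,3))
  ultimately show "phi1 (u - v) = phi1 u - phi1 v"
    by (intro phi1_eq)
  then show "phi2 (u - v) = phi2 u - phi2 v"
    by (simp add: phi2_def diff)
qed

lemma phi_mult_parts:
  assumes "i \<noteq> j" "x \<in> block i j" "k \<noteq> l" "y \<in> block k l"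
  shows "\<phi> x * \<phi> y = phi1 x * phi1 y + phi2 x * phi2 y"
    "phi1 x * phi1 y \<in> forward_ring" "phi2 x * phi2 y \<in> backward_ring"
  using phi_parts [OF assms(1,2)] phi_parts [OF assms(3,4)]
  by (simp_all add: phi_eq_parts [of x] phi_eq_parts [of y] left_diff_distrib right_diff_distrib part_mult
      forward_backward_eq_0 backward_forward_eq_0)

text \<open>
  The two contributions to \<open>\<phi> x \<phi> y\<close> lie in rings with zero intersection, so the position of
  the product decides which of them survives.
\<close>

lemma parts_mult_forward:
  assumes "i \<noteq> j" "x \<in> block i j" "k \<noteq> l" "y \<in> block k l" "\<phi> x * \<phi> y \<in> forward_ring"
  shows "phi1 x * phi1 y = \<phi> x * \<phi> y" "phi2 x * phi2 y = 0"
proof -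
  have "phi2 x * phi2 y = \<phi> x * \<phi> y - phi1 x * phi1 y"
    using phi_mult_parts [OF assms(1-4)] by simp
  then have "phi2 x * phi2 y \<in> forward_ring"
    using part_diff [OF assms(5) phi_mult_parts(2) [OF assms(1-4)]] by (simp only:)
  then show "phi2 x * phi2 y = 0"
    using phi_mult_parts [OF assms(1-4)] by (intro forward_Int_backward) auto
  then show "phi1 x * phi1 y = \<phi> x * \<phi> y"
    using phi_mult_parts [OF assms(1-4)] by simp
qed

lemma parts_mult_backward:
  assumes "i \<noteq> j" "x \<in> block i j" "k \<noteq> l" "y \<in> block k l" "\<phi> x * \<phi> y \<in> backward_ring"
  shows "phi2 x * phi2 y = \<phi> x * \<phi> y" "phi1 x * phi1 y = 0"
proof -
  have "phi1 x * phi1 y = \<phi> x * \<phi> y - phi2 x * phi2 y"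
    using phi_mult_parts [OF assms(1-4)] by simp
  then have "phi1 x * phi1 y \<in> backward_ring"
    using part_diff [OF assms(5) phi_mult_parts(3) [OF assms(1-4)]] by (simp only:)
  then show "phi1 x * phi1 y = 0"
    using phi_mult_parts [OF assms(1-4)] by (intro forward_Int_backward) auto
  then show "phi2 x * phi2 y = \<phi> x * \<phi> y"
    using phi_mult_parts [OF assms(1-4)] by simp
qed

lemma parts_chain:
  assumes "distinct [i, j, k]" "x \<in> block i j" "y \<in> block j k"
  shows "phi1 x * phi1 y = phi1 (x * y)" "phi2 y * phi2 x = phi2 (x * y)"
    "phi1 y * phi1 x = 0" "phi2 x * phi2 y = 0"
proof -
  have ne: "i \<noteq> j" "j \<noteq> k"
    using assms(1) by auto
  note B = phi_chain_in_parts [OF assms]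
  have 1: "phi1 (x * y) = \<phi> x * \<phi> y"
    using phi_chain [OF assms(2,3,1)] B part_diff [OF part_zero B(2)] by (intro phi1_eq) auto
  then have "phi2 (x * y) = \<phi> y * \<phi> x"
    using phi_chain [OF assms(2,3,1)] by (simp add: phi2_def)
  with 1 show "phi1 x * phi1 y = phi1 (x * y)" "phi2 y * phi2 x = phi2 (x * y)"
    "phi1 y * phi1 x = 0" "phi2 x * phi2 y = 0"
    using parts_mult_forward [OF ne(1) assms(2) ne(2) assms(3) B(1)]
      parts_mult_backward [OF ne(2) assms(3) ne(1) assms(2) B(2)] by simp_all
qed

lemma parts_zero_product:
  assumes "i \<noteq> j" "k \<noteq> l" "j \<noteq> k" "x \<in> block i j" "y \<in> block k l"
  shows "phi1 x * phi1 y = 0" "phi2 y * phi2 x = 0"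
proof -
  have "phi1 x * phi1 y = 0 \<and> phi2 y * phi2 x = 0"
  proof (cases "i = l")
    case True
    then show ?thesis
      using parts_chain [of k i j y x] assms by auto
  next
    case False
    have 0: "\<phi> x * \<phi> y = 0" "\<phi> y * \<phi> x = 0"
      using assms False phi_mult_eq_0 [OF assms(4,5)] phi_mult_eq_0 [OF assms(5,4)] by auto
    show ?thesis
      using parts_mult_backward(2) [OF assms(1,4,2,5)] parts_mult_forward(2) [OF assms(2,5,1,4)]
      by (simp add: 0 part_zero)
  qed
  then show "phi1 x * phi1 y = 0" "phi2 y * phi2 x = 0"
    by simp_all
qed

end

section \<open>Extending an off-diagonal homomorphism to the whole ring\<close>

text \<open>
  A map that is additive and multiplicative as far as products of off-diagonal blocks stay off the
  diagonal. The multiplication of the target is a parameter, so that homomorphisms and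
  anti-homomorphisms are covered at once. The last hypothesis replaces a unit in the target.
\<close>

locale block_extension = peirce_frame lm rm
  for lm rm :: "idx \<Rightarrow> 'a::ring \<Rightarrow> 'a" +
  fixes mul :: "'b::ab_group_add \<Rightarrow> 'b \<Rightarrow> 'b" (infixl "\<odot>" 70)
    and C :: "'b set" and f :: "'a \<Rightarrow> 'b"
  assumes mul_assoc: "(a \<odot> b) \<odot> c = a \<odot> (b \<odot> c)"
    and mul_diff_left: "(a - b) \<odot> c = a \<odot> c - b \<odot> c"
    and mul_diff_right: "c \<odot> (a - b) = c \<odot> a - c \<odot> b"
    and C_zero: "0 \<in> C"
    and C_diff: "c \<in> C \<Longrightarrow> d \<in> C \<Longrightarrow> c - d \<in> C"
    and C_mul: "c \<in> C \<Longrightarrow> d \<in> C \<Longrightarrow> c \<odot> d \<in> C"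
    and f_in: "i \<noteq> j \<Longrightarrow> u \<in> block i j \<Longrightarrow> f u \<in> C"
    and f_diff: "i \<noteq> j \<Longrightarrow> u \<in> block i j \<Longrightarrow> v \<in> block i j \<Longrightarrow> f (u - v) = f u - f v"
    and f_chain: "distinct [i, j, k] \<Longrightarrow> u \<in> block i j \<Longrightarrow> v \<in> block j k \<Longrightarrow> f u \<odot> f v = f (u * v)"
    and f_zero_product:
      "i \<noteq> j \<Longrightarrow> k \<noteq> l \<Longrightarrow> j \<noteq> k \<Longrightarrow> u \<in> block i j \<Longrightarrow> v \<in> block k l \<Longrightarrow> f u \<odot> f v = 0"
    and faithful: "c \<in> C \<Longrightarrow>
      (\<And>i j u. i \<noteq> j \<Longrightarrow> u \<in> block i j \<Longrightarrow> c \<odot> f u = 0 \<and> f u \<odot> c = 0) \<Longrightarrow> c = 0"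
begin

text \<open>
  \<open>c\<close> represents \<open>a \<in> A\<^sub>p\<^sub>q\<close> if it multiplies the values of \<open>f\<close> as the image of \<open>a\<close> has to,
  wherever the product with \<open>a\<close> stays off the diagonal. The excluded column \<open>p\<close> and
  row \<open>q\<close> are exactly where \<open>a z\<close> and \<open>z a\<close> may be diagonal.
\<close>

definition rep :: "idx \<Rightarrow> idx \<Rightarrow> 'a \<Rightarrow> 'b \<Rightarrow> bool"
  where "rep p q a c \<longleftrightarrow> c \<in> C \<and>
    (\<forall>j k. \<forall>z\<in>block j k. j \<noteq> k \<longrightarrow> k \<noteq> p \<longrightarrow> c \<odot> f z = f (a * z)) \<and>
    (\<forall>j k. \<forall>z\<in>block j k. j \<noteq> k \<longrightarrow> j \<noteq> q \<longrightarrow> f z \<odot> c = f (z * a))"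

lemma rep_in: "rep p q a c \<Longrightarrow> c \<in> C"
  and rep_right: "rep p q a c \<Longrightarrow> z \<in> block j k \<Longrightarrow> j \<noteq> k \<Longrightarrow> k \<noteq> p \<Longrightarrow> c \<odot> f z = f (a * z)"
  and rep_left: "rep p q a c \<Longrightarrow> z \<in> block j k \<Longrightarrow> j \<noteq> k \<Longrightarrow> j \<noteq> q \<Longrightarrow> f z \<odot> c = f (z * a)"
  unfolding rep_def by blast+

lemma mul_zero [simp]: "0 \<odot> c = 0" "c \<odot> 0 = 0"
  using mul_diff_left [of 0 0 c] mul_diff_right [of c 0 0] by simp_all

lemma f_0 [simp]: "f 0 = 0"
  using f_diff [of I1 I2 0 0] by simp

lemma rep_zero: "rep p q 0 0"
  by (simp add: rep_def C_zero)

lemma rep_diff: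
  assumes "a \<in> block p q" "b \<in> block p q" "rep p q a c" "rep p q b d"
  shows "rep p q (a - b) (c - d)"
proof -
  have "(c - d) \<odot> f z = f ((a - b) * z)" if "z \<in> block j k" "j \<noteq> k" "k \<noteq> p" for j k z
    using rep_right [OF assms(3) that] rep_right [OF assms(4) that]
      f_diff [of p k "a * z" "b * z"] block_mult [OF assms(1) that(1)] block_mult [OF assms(2) that(1)] that
    by (auto simp: mul_diff_left left_diff_distrib)
  moreover have "f z \<odot> (c - d) = f (z * (a - b))" if "z \<in> block j k" "j \<noteq> k" "j \<noteq> q" for j k z
    using rep_left [OF assms(3) that] rep_left [OF assms(4) that]
      f_diff [of j q "z * a" "z * b"] block_mult [OF that(1) assms(1)] block_mult [OF that(1) assms(2)] that
    by (auto simp: mul_diff_right right_diff_distrib)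
  ultimately show ?thesis
    using rep_in [OF assms(3)] rep_in [OF assms(4)] by (auto simp: rep_def C_diff)
qed

text \<open>
  In the excluded column, factor \<open>z\<close> through a further index: \<open>f z = f x \<odot> f y\<close>, and
  \<open>c \<odot> f x\<close> is prescribed.
\<close>

lemma rep_0_eq_0:
  assumes "rep p q 0 c"
  shows "c = 0"
proof (rule faithful [OF rep_in [OF assms]])
  fix j k z
  assume jk: "j \<noteq> k" and z: "z \<in> block j k"
  obtain t where t: "t \<noteq> j" "t \<noteq> k" "t \<noteq> k"
    by (rule ex_idx_avoiding)
  have "c \<odot> f z = 0"
  proof (cases "k = p")
    case True
    show ?thesis
      using z
    proof (induction rule: block_induct [where j = t])
      case (diff a b)
      then show ?case
        by (simp add: f_diff [OF jk] mul_diff_right)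
    next
      case (mult x y)
      have "c \<odot> f x = 0"
        using rep_right [OF assms mult(1)] t True by auto
      moreover have "f (x * y) = f x \<odot> f y"
        using f_chain [OF _ mult] t jk by auto
      ultimately show ?case
        by (simp flip: mul_assoc)
    qed simp
  next
    case False
    then show ?thesis
      using rep_right [OF assms z jk] by simp
  qed
  moreover have "f z \<odot> c = 0"
  proof (cases "j = q")
    case True
    show ?thesis
      using z
    proof (induction rule: block_induct [where j = t])
      case (diff a b)
      then show ?case
        by (simp add: f_diff [OF jk] mul_diff_left)
    next
      case (mult x y)
      have "f y \<odot> c = 0"
        using rep_left [OF assms mult(2)] t True by auto
      moreover have "f (x * y) = f x \<odot> f y"
        using f_chain [OF _ mult] t jk by auto
      ultimately show ?case
        by (simp add: mul_assoc)
    qed simp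
  next
    case False
    then show ?thesis
      using rep_left [OF assms z jk] by simp
  qed
  ultimately show "c \<odot> f z = 0 \<and> f z \<odot> c = 0" ..
qed

lemma rep_unique: "a \<in> block p q \<Longrightarrow> rep p q a c \<Longrightarrow> rep p q a d \<Longrightarrow> c = d"
  using rep_diff [of a p q a c d] rep_0_eq_0 [of p q "c - d"] by simp

lemma rep_off_diagonal:
  assumes "p \<noteq> q" and a: "a \<in> block p q"
  shows "rep p q a (f a)"
proof -
  have "f a \<odot> f z = f (a * z)" if z: "z \<in> block j k" "j \<noteq> k" "k \<noteq> p" for j k z
    using f_chain [OF _ a, of k z] f_zero_product [OF _ _ _ a z(1)] block_mult_eq_0 [OF a z(1)] z assms(1)
    by (cases "j = q") auto
  moreover have "f z \<odot> f a = f (z * a)" if z: "z \<in> block j k" "j \<noteq> k" "j \<noteq> q" for j k z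
    using f_chain [OF _ _ a, of j z] f_zero_product [OF _ _ _ z(1) a] block_mult_eq_0 [OF z(1) a] z assms(1)
    by (cases "k = p") auto
  ultimately show ?thesis
    using f_in [OF assms] by (auto simp: rep_def)
qed

text \<open>
  Representing is multiplicative for all pairs of blocks, including those whose product is zero. The
  condition on \<open>c \<odot> d\<close> follows by applying those on \<open>d\<close> and \<open>c\<close> in turn, unless the
  intermediate product is diagonal. Then \<open>z\<close> is factored through an index \<open>t\<close> that avoids three
  others, which is possible as there are four.
\<close>

lemma rep_mult:
  assumes a: "a \<in> block p q" and c: "rep p q a c" and b: "b \<in> block s r" and d: "rep s r b d"
  shows "rep p r (a * b) (c \<odot> d)"
proof -
  have "c \<odot> d \<odot> f z = f (a * b * z)" if z: "z \<in> block j k" "j \<noteq> k" "k \<noteq> p" for j k z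
  proof (cases "k = s")
    case True
    obtain t where t: "t \<noteq> j" "t \<noteq> s" "t \<noteq> p"
      by (rule ex_idx_avoiding)
    show ?thesis
      using z(1)
    proof (induction rule: block_induct [where j = t])
      case (diff x y)
      have "a * b * x \<in> block p k" "a * b * y \<in> block p k"
        using a b diff block_mult by blast+
      then show ?case
        using diff z f_diff [of p k "a * b * x" "a * b * y"]
        by (auto simp: f_diff [OF z(2)] mul_diff_right right_diff_distrib)
    next
      case (mult x y)
      have bx: "b * x \<in> block s t"
        using block_mult [OF b mult(1)] .
      have abx: "a * (b * x) \<in> block p t"
        using block_mult [OF a bx] .
      have "c \<odot> d \<odot> f (x * y) = c \<odot> (d \<odot> f x) \<odot> f y"
        using f_chain [OF _ mult] t z True by (auto simp: mul_assoc)
      also have "d \<odot> f x = f (b * x)"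
        using rep_right [OF d mult(1)] t by auto
      also have "c \<odot> f (b * x) = f (a * (b * x))"
        using rep_right [OF c bx] t by auto
      also have "f (a * (b * x)) \<odot> f y = f (a * (b * x) * y)"
        using f_chain [OF _ abx mult(2)] t z True by auto
      finally show ?case
        by (simp add: mult.assoc)
    qed simp
  next
    case False
    have "c \<odot> d \<odot> f z = c \<odot> f (b * z)"
      using rep_right [OF d z(1,2)] False by (simp add: mul_assoc)
    also have "\<dots> = f (a * (b * z))"
      using rep_right [OF c block_mult [OF b z(1)]] False z by auto
    finally show ?thesis
      by (simp add: mult.assoc)
  qed
  moreover have "f z \<odot> (c \<odot> d) = f (z * (a * b))" if z: "z \<in> block j k" "j \<noteq> k" "j \<noteq> r" for j k z
  proof (cases "j = q")
    case True
    obtain t where t: "t \<noteq> q" "t \<noteq> k" "t \<noteq> r"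
      by (rule ex_idx_avoiding)
    show ?thesis
      using z(1)
    proof (induction rule: block_induct [where j = t])
      case (diff x y)
      have "x * (a * b) \<in> block j r" "y * (a * b) \<in> block j r"
        using a b diff block_mult by blast+
      then show ?case
        using diff z f_diff [of j r "x * (a * b)" "y * (a * b)"]
        by (auto simp: f_diff [OF z(2)] mul_diff_left left_diff_distrib)
    next
      case (mult x y)
      have ya: "y * a \<in> block t q"
        using block_mult [OF mult(2) a] .
      have yab: "y * a * b \<in> block t r"
        using block_mult [OF ya b] .
      have "f (x * y) = f x \<odot> f y"
        using f_chain [OF _ mult] t z True by auto
      then have "f (x * y) \<odot> (c \<odot> d) = f x \<odot> (f y \<odot> c \<odot> d)"
        by (simp add: mul_assoc)
      also have "f y \<odot> c = f (y * a)"
        using rep_left [OF c mult(2)] t by auto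
      also have "f (y * a) \<odot> d = f (y * a * b)"
        using rep_left [OF d ya] t by auto
      also have "f x \<odot> f (y * a * b) = f (x * (y * a * b))"
        using f_chain [OF _ mult(1) yab] t z True by auto
      finally show ?case
        by (simp add: mult.assoc)
    qed simp
  next
    case False
    have "f z \<odot> (c \<odot> d) = f (z * a) \<odot> d"
      using rep_left [OF c z(1,2)] False by (simp flip: mul_assoc)
    also have "\<dots> = f (z * a * b)"
      using rep_left [OF d block_mult [OF z(1) a]] False z by auto
    finally show ?thesis
      by (simp add: mult.assoc)
  qed
  ultimately show ?thesis
    using C_mul rep_in [OF c] rep_in [OF d] by (auto simp: rep_def)
qed

text \<open>
  A diagonal element is a sum of products of off-diagonal ones, whose representing elements are known.
\<close>

lemma rep_exists:
  assumes a: "a \<in> block p q"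
  shows "\<exists>c. rep p q a c"
proof (cases "p = q")
  case True
  obtain t where t: "t \<noteq> p" "t \<noteq> p" "t \<noteq> p"
    by (rule ex_idx_avoiding)
  show ?thesis
    using a
  proof (induction rule: block_induct [where j = t])
    case zero
    then show ?case
      using rep_zero by blast
  next
    case (diff x y)
    then show ?case
      using rep_diff by blast
  next
    case (mult x y)
    then show ?case
      using rep_mult [OF mult(1) rep_off_diagonal [OF _ mult(1)] mult(2) rep_off_diagonal [OF _ mult(2)]] t True
      by auto
  qed
next
  case False
  then show ?thesis
    using rep_off_diagonal a by blast
qed

definition ext_block :: "idx \<Rightarrow> idx \<Rightarrow> 'a \<Rightarrow> 'b"
  where "ext_block p q a = (THE c. rep p q a c)"

definition ext :: "'a \<Rightarrow> 'b"
  where "ext a = (\<Sum>p\<in>UNIV. \<Sum>q\<in>UNIV. ext_block p q (component p q a))"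

lemma ext_block_eq: "a \<in> block p q \<Longrightarrow> rep p q a c \<Longrightarrow> ext_block p q a = c"
  unfolding ext_block_def using rep_unique by blast

lemma rep_ext_block: "a \<in> block p q \<Longrightarrow> rep p q a (ext_block p q a)"
  using rep_exists [of a p q] ext_block_eq by metis

lemma ext_block_diff:
  "a \<in> block p q \<Longrightarrow> b \<in> block p q \<Longrightarrow> ext_block p q (a - b) = ext_block p q a - ext_block p q b"
  by (intro ext_block_eq rep_diff rep_ext_block block_diff)

lemma ext_block_zero [simp]: "ext_block p q 0 = 0"
  using ext_block_diff [of 0 p q 0] by simp

lemma ext_block_add:
  assumes "a \<in> block p q" "b \<in> block p q"
  shows "ext_block p q (a + b) = ext_block p q a + ext_block p q b"
  using ext_block_diff [of "a + b" p q b] assms by (simp add: block_add)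

lemma block_sum: "(\<And>s. g s \<in> block p q) \<Longrightarrow> (\<Sum>s\<in>UNIV. g s) \<in> block p q" for g :: "idx \<Rightarrow> 'a"
  by (simp add: sum_idx block_add)

lemma ext_block_sum:
  fixes g :: "idx \<Rightarrow> 'a"
  shows "(\<And>s. g s \<in> block p q) \<Longrightarrow> ext_block p q (\<Sum>s\<in>UNIV. g s) = (\<Sum>s\<in>UNIV. ext_block p q (g s))"
  by (simp add: sum_idx ext_block_add block_add)

lemma ext_block_mult:
  "a \<in> block p q \<Longrightarrow> b \<in> block s r \<Longrightarrow> ext_block p q a \<odot> ext_block s r b = ext_block p r (a * b)"
  by (rule ext_block_eq [symmetric]) (auto intro: block_mult rep_mult rep_ext_block)

lemma ext_in: "ext a \<in> C"
proof -
  have C_add: "c + d \<in> C" if "c \<in> C" "d \<in> C" for c d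
    using C_diff [OF that(1) C_diff [OF C_zero that(2)]] by simp
  have "ext_block p q (component p q a) \<in> C" for p q
    using rep_in rep_ext_block component_in_block by blast
  then show ?thesis
    by (simp add: ext_def sum_idx C_add)
qed

lemma ext_add: "ext (a + b) = ext a + ext b"
  by (simp add: ext_def component_add ext_block_add sum.distrib)

lemma ext_mult: "ext (a * b) = ext a \<odot> ext b"
proof -
  have mul_add: "(c + d) \<odot> e = c \<odot> e + d \<odot> e" "e \<odot> (c + d) = e \<odot> c + e \<odot> d" for c d e
    using mul_diff_left [of "c + d" d e] mul_diff_right [of e "c + d" d] by simp_all
  have mul_sum: "(\<Sum>p\<in>UNIV. g p) \<odot> c = (\<Sum>p\<in>UNIV. g p \<odot> c)"
    "c \<odot> (\<Sum>p\<in>UNIV. g p) = (\<Sum>p\<in>UNIV. c \<odot> g p)" for g :: "idx \<Rightarrow> 'b" and c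
    by (simp_all add: sum_idx mul_add)
  have component_product: "component p r (a * b) = (\<Sum>q\<in>UNIV. \<Sum>s\<in>UNIV. component p q a * component s r b)" for p r
  proof -
    have "(\<Sum>q\<in>UNIV. component p q a) = lm p a"
      unfolding component_def lm_rm by (rule sum_rm)
    moreover have "(\<Sum>s\<in>UNIV. component s r b) = rm r b"
      unfolding component_def by (rule sum_lm)
    ultimately show ?thesis
      by (simp add: component_def lm_mult rm_mult flip: sum_distrib_left sum_distrib_right)
  qed
  have product: "ext_block p r (component p r (a * b)) =
    (\<Sum>q\<in>UNIV. \<Sum>s\<in>UNIV. ext_block p q (component p q a) \<odot> ext_block s r (component s r b))" for p r
  proof -
    have "ext_block p r (component p r (a * b)) =
      (\<Sum>q\<in>UNIV. ext_block p r (\<Sum>s\<in>UNIV. component p q a * component s r b))"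
      unfolding component_product
      by (intro ext_block_sum block_sum block_mult [OF component_in_block component_in_block])
    also have "\<dots> = (\<Sum>q\<in>UNIV. \<Sum>s\<in>UNIV. ext_block p r (component p q a * component s r b))"
      by (intro sum.cong refl ext_block_sum block_mult [OF component_in_block component_in_block])
    finally show ?thesis
      by (simp add: ext_block_mult)
  qed
  have swap: "(\<Sum>r\<in>UNIV. \<Sum>q\<in>UNIV. \<Sum>s\<in>UNIV. g q s r) = (\<Sum>q\<in>UNIV. \<Sum>s\<in>UNIV. \<Sum>r\<in>UNIV. g q s r)"
    for g :: "idx \<Rightarrow> idx \<Rightarrow> idx \<Rightarrow> 'b"
    by (rule trans [OF sum.swap]) (rule sum.cong [OF refl], rule sum.swap)
  have "ext (a * b) = (\<Sum>p\<in>UNIV. \<Sum>r\<in>UNIV. \<Sum>q\<in>UNIV. \<Sum>s\<in>UNIV.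
      ext_block p q (component p q a) \<odot> ext_block s r (component s r b))"
    by (simp add: ext_def product)
  also have "\<dots> = (\<Sum>p\<in>UNIV. \<Sum>q\<in>UNIV. \<Sum>s\<in>UNIV. \<Sum>r\<in>UNIV.
      ext_block p q (component p q a) \<odot> ext_block s r (component s r b))"
    by (rule sum.cong [OF refl], rule swap)
  also have "\<dots> = (\<Sum>p\<in>UNIV. \<Sum>q\<in>UNIV. ext_block p q (component p q a) \<odot> ext b)"
    by (simp only: ext_def [of b] mul_sum(2))
  also have "\<dots> = ext a \<odot> ext b"
    by (simp only: ext_def [of a] mul_sum(1))
  finally show ?thesis .
qed

lemma ext_off_diagonal:
  assumes "i \<noteq> j" "u \<in> block i j"
  shows "ext u = f u"
proof -
  have "ext_block p q (component p q u) = (if q = j then if p = i then f u else 0 else 0)" for p q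
    using ext_block_eq [OF assms(2) rep_off_diagonal [OF assms]] by (simp add: component_block [OF assms(2)])
  then show ?thesis
    by (simp add: ext_def)
qed

end

section \<open>The standard extension\<close>

context lie_iso
begin

text \<open>
  Faithfulness of either part of \<open>\<phi>\<close>: an element of one of the two rings is annihilated by the
  other part anyway, so the zero annihilator of the generated subring decides.
\<close>

lemma faithful_part:
  assumes "c \<in> subring_B"
    and "\<And>i j u. i \<noteq> j \<Longrightarrow> u \<in> block i j \<Longrightarrow> c * phi1 u = 0 \<and> phi1 u * c = 0"
    and "\<And>i j u. i \<noteq> j \<Longrightarrow> u \<in> block i j \<Longrightarrow> c * phi2 u = 0 \<and> phi2 u * c = 0"
  shows "c = 0"
proof (rule subring_B_eq_0 [OF assms(1)])
  fix i j u
  assume "i \<noteq> j" "u \<in> block i j"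
  then show "c * \<phi> u = 0 \<and> \<phi> u * c = 0"
    using assms(2,3) [of i j u] by (simp add: phi_eq_parts [of u] left_diff_distrib right_diff_distrib)
qed

sublocale part1: block_extension lm rm "(*)" forward_ring phi1
proof
  show "c = 0" if c: "c \<in> forward_ring"
    and 0: "\<And>i j u. i \<noteq> j \<Longrightarrow> u \<in> block i j \<Longrightarrow> c * phi1 u = 0 \<and> phi1 u * c = 0" for c
  proof (rule faithful_part)
    show "c \<in> subring_B"
      using c parts_subset by blast
    show "c * phi2 u = 0 \<and> phi2 u * c = 0" if "i \<noteq> j" "u \<in> block i j" for i j u
      using c phi_parts [OF that] forward_backward_eq_0 backward_forward_eq_0 by blast
  qed (use 0 in blast)
qed (simp_all add: mult.assoc left_diff_distrib right_diff_distrib part_zero part_diff part_mult phi_parts phi1_diff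
      parts_chain parts_zero_product)

sublocale part2: block_extension lm rm "\<lambda>a b. b * a" backward_ring phi2
proof
  show "c = 0" if c: "c \<in> backward_ring"
    and 0: "\<And>i j u. i \<noteq> j \<Longrightarrow> u \<in> block i j \<Longrightarrow> phi2 u * c = 0 \<and> c * phi2 u = 0" for c
  proof (rule faithful_part)
    show "c \<in> subring_B"
      using c parts_subset by blast
    show "c * phi1 u = 0 \<and> phi1 u * c = 0" if "i \<noteq> j" "u \<in> block i j" for i j u
      using c phi_parts [OF that] forward_backward_eq_0 backward_forward_eq_0 by blast
  qed (use 0 in blast)
qed (simp_all add: mult.assoc left_diff_distrib right_diff_distrib part_zero part_diff part_mult phi_parts phi1_diff
      parts_chain parts_zero_product)

text \<open>
  By orthogonality, the difference of the two extensions is a homomorphism of Lie rings. It agrees with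
  \<open>\<phi>\<close> on the off-diagonal blocks, and these generate \<open>[A, A]\<close>.
\<close>

theorem extends_to_standard_map:
  "\<exists>\<Phi> :: 'a \<Rightarrow> 'b. standard_map \<Phi> \<and> (\<forall>a \<in> derived_ring. \<Phi> a = \<phi> a)"
proof -
  define \<Phi> where "\<Phi> a = part1.ext a - part2.ext a" for a
  have zero: "part1.ext a * part2.ext b = 0" "part2.ext a * part1.ext b = 0" for a b
    using forward_backward_eq_0 backward_forward_eq_0 part1.ext_in part2.ext_in by blast+
  have add: "\<Phi> (a + b) = \<Phi> a + \<Phi> b" for a b
    by (simp add: \<Phi>_def part1.ext_add part2.ext_add)
  then have diff: "\<Phi> (a - b) = \<Phi> a - \<Phi> b" for a b
    using add [of "a - b" b] by simp
  have "standard_map \<Phi>"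
    unfolding standard_map_def
  proof (intro conjI exI)
    show "additive \<Phi>"
      by (rule additive.intro) (rule add)
    show "ring_homomorphism part1.ext" "ring_antihomomorphism part2.ext"
      by (auto simp: ring_homomorphism_def ring_antihomomorphism_def part1.ext_mult part2.ext_mult
          intro: additive.intro part1.ext_add part2.ext_add)
  qed (auto simp: zero \<Phi>_def)
  moreover have "\<Phi> a = \<phi> a" if "a \<in> derived_ring" for a
    using that
  proof (induction rule: derived_ring_induct)
    case (diff x y)
    then show ?case
      by (simp add: \<open>\<And>a b. \<Phi> (a - b) = \<Phi> a - \<Phi> b\<close> phi_diff)
  next
    case (off_diagonal i j x)
    then show ?case
      by (simp add: \<Phi>_def part1.ext_off_diagonal part2.ext_off_diagonal phi_eq_parts)
  next
    case (commutator i j x y)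
    have phi: "\<Phi> x = \<phi> x" "\<Phi> y = \<phi> y"
      using commutator part1.ext_off_diagonal [of i j x] part2.ext_off_diagonal [of i j x]
        part1.ext_off_diagonal [of j i y] part2.ext_off_diagonal [of j i y]
      by (simp_all add: \<Phi>_def phi_eq_parts)
    have product: "\<Phi> x * \<Phi> y = part1.ext (x * y) + part2.ext (y * x)" for x y
      by (simp add: \<Phi>_def part1.ext_mult part2.ext_mult left_diff_distrib right_diff_distrib zero)
    have "\<Phi> (commutator x y) = commutator (\<Phi> x) (\<Phi> y)"
      unfolding commutator_def product diff by (simp add: \<Phi>_def)
    also have "\<dots> = \<phi> (commutator x y)"
      using commutator block_in_derived_ring [of i j x] block_in_derived_ring [of j i y]
      by (simp add: phi phi_commutator)
    finally show ?case .
  qed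
  ultimately show ?thesis
    by blast
qed

end

theorem corollary1:
  fixes e1 e2 e3 :: "'a::ring" and \<phi> :: "'a \<Rightarrow> 'b::ring"
  assumes "e1 * e1 = e1" "e2 * e2 = e2" "e3 * e3 = e3"
    and "e1 * e2 = 0" "e2 * e1 = 0" "e1 * e3 = 0" "e3 * e1 = 0" "e2 * e3 = 0" "e3 * e2 = 0"
    and "two_sided_product e1 = UNIV" "two_sided_product e2 = UNIV" "two_sided_product e3 = UNIV"
    and "two_sided_product_compl (e1 + e2 + e3) = UNIV"
    and "annihilator (generated_subring (derived_ring :: 'b set)) = {0}"
    and "lie_ring_iso_on (derived_ring :: 'a set) (derived_ring :: 'b set) \<phi>"
  shows "\<exists>\<Phi> :: 'a \<Rightarrow> 'b. standard_map \<Phi> \<and> (\<forall>a \<in> derived_ring. \<Phi> a = \<phi> a)"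
proof -
  note idem = assms(1-9)
  have absorb: "e1 * (e1 * a) = e1 * a" "e2 * (e2 * a) = e2 * a" "e3 * (e3 * a) = e3 * a"
    "e1 * (e2 * a) = 0" "e2 * (e1 * a) = 0" "e1 * (e3 * a) = 0"
    "e3 * (e1 * a) = 0" "e2 * (e3 * a) = 0" "e3 * (e2 * a) = 0" for a
    using idem by (simp_all flip: mult.assoc)
  define lm where "lm i a =
    (case i of I1 \<Rightarrow> e1 * a | I2 \<Rightarrow> e2 * a | I3 \<Rightarrow> e3 * a | I4 \<Rightarrow> a - (e1 * a + e2 * a + e3 * a))" for i a
  define rm where "rm i a =
    (case i of I1 \<Rightarrow> a * e1 | I2 \<Rightarrow> a * e2 | I3 \<Rightarrow> a * e3 | I4 \<Rightarrow> a - (a * e1 + a * e2 + a * e3))" for i a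
  \<comment> \<open>The operators for the fourth index are those of \<open>1 - e1 - e2 - e3\<close> in the unital hull.\<close>
  interpret lie_iso lm rm \<phi>
  proof
    fix i j and a b :: 'a
    show "lm i (a - b) = lm i a - lm i b" "rm i (a - b) = rm i a - rm i b"
      "lm i (a * b) = lm i a * b" "rm i (a * b) = a * rm i b" "rm i a * b = a * lm i b"
      by (cases i; simp add: lm_def rm_def algebra_simps)+
    show "lm i (lm j a) = (if i = j then lm i a else 0)"
      by (cases i; cases j; simp add: lm_def distrib_left right_diff_distrib absorb)
    show "rm i (rm j a) = (if i = j then rm i a else 0)"
      by (cases i; cases j; simp add: rm_def distrib_right left_diff_distrib mult.assoc idem)
    show "lm i (rm j a) = rm j (lm i a)"
      by (cases i; cases j; simp add: lm_def rm_def algebra_simps)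
    show "(\<Sum>i\<in>UNIV. lm i a) = a" "(\<Sum>i\<in>UNIV. rm i a) = a"
      by (simp_all add: sum_idx lm_def rm_def)
    show "a \<in> group_closure {x * lm i y | x y. True}"
    proof (cases i)
      case I4
      have "{x * lm i y | x y. True} = {x * y - x * (e1 + e2 + e3) * y | x y. True}"
        by (simp add: I4 lm_def algebra_simps)
      then show ?thesis
        using assms(13) by (auto simp: two_sided_product_compl_def)
    qed (use assms(10-12) in \<open>auto simp: two_sided_product_def lm_def mult.assoc\<close>)
    show "(\<exists>e. \<forall>a. lm i a = e * a \<and> rm i a = a * e) \<or> (\<exists>e. \<forall>a. lm j a = e * a \<and> rm j a = a * e)" if "i \<noteq> j"
      using that by (cases i; cases j) (auto simp: lm_def rm_def)
  qed (use assms(14,15) in simp_all)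
  show ?thesis
    by (rule extends_to_standard_map)
qed

end
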